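(* Let $\lambda<\mu$, where $\lambda$ is an infinite cardinal and $\mu$ is an infinite cardinal or $\infty$. If $\mathfrak{s}=(\mathbf{K},\downarrow,\mathbf{S}^{bs})$ is a w-good $[\lambda,\mu)$-frame, then $\mathbf{K}_{\kappa}\neq\emptyset$ for all cardinals $\kappa\in[\lambda,\mu^{+}]$ (if $\mu=\infty$, this means for all cardinals $\kappa\ge\lambda$).
   Context: **AECs.** An abstract elementary class (AEC) is a pair $\mathbf{K}=(K,\leq_{\mathbf{K}})$, $K$ a class of $\tau$-structures for a fixed vocabulary $\tau$, $\leq_{\mathbf{K}}$ a partial order on $K$, both closed under isomorphism, such that: $M\leq_{\mathbf{K}}N$ implies $M\subseteq N$; if $M_0,M_1\leq_{\mathbf{K}}M_2$ and $M_0\subseteq M_1$ then $M_0\leq_{\mathbf{K}}M_1$; the union of a $\leq_{\mathbf{K}}$-increasing continuous chain is in $K$, is $\leq_{\mathbf{K}}$-above each member, and is $\leq_{\mathbf{K}}$-below any $N\in K$ that is above all members; there is a least infinite cardinal $\mathrm{LS}(\mathbf{K})\ge|\tau|$ such that for $A\subseteq|N|$, $N\in K$, there is $M\leq_{\mathbf{K}}N$ with $A\subseteq|M|$ and $\|M\|\le|A|+\mathrm{LS}(\mathbf{K})$. $|M|$ is the universe, $\|M\|$ its cardinality. $f:M\to N$ is a $\mathbf{K}$-embedding if it is an isomorphism onto some $f[M]\leq_{\mathbf{K}}N$; $f:M\to_A N$ means moreover that $f$ fixes $A$ pointwise. $M<_{\mathbf{K}}N$ means $M\leq_{\mathbf{K}}N$,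 $M\ne N$. $\mathbf{K}_\kappa$ (resp. $\mathbf{K}_I$) is the class of models of cardinality $\kappa$ (resp. with cardinality in $I$); $[\lambda,\mu)$ is an interval of cardinals. $\mathbf{K}_I$ has *amalgamation* if for all $M\leq_{\mathbf{K}}N,R$ in $\mathbf{K}_I$ there are $R^*\in\mathbf{K}$, $R\leq_{\mathbf{K}}R^*$, and a $\mathbf{K}$-embedding $f:N\to_M R^*$; *joint embedding* if for all $M,N\in\mathbf{K}_I$ there are $R^*\geq_{\mathbf{K}}N$ in $\mathbf{K}$ and a $\mathbf{K}$-embedding $M\to R^*$; *no maximal models* if each $M\in\mathbf{K}_I$ has some $M^*\in\mathbf{K}$ with $M<_{\mathbf{K}}M^*$. **Galois types.** For triples $(a,M,N)$ with $M\leq_{\mathbf{K}}N$, $a\in|N|$, put $(a_0,M,N_0)E_{at}(a_1,M,N_1)$ if there are $N\in\mathbf{K}$ and $\mathbf{K}$-embeddings $f_l:N_l\to_M N$ with $f_0(a_0)=f_1(a_1)$; $E$ is the transitive closure of $E_{at}$; $\mathbf{tp}(a/M,N)$ is the $E$-class. $\mathbf{S}(M)$ is the set of Galois types over $M$, $\mathbf{S}^{na}(M)$ the set of those with $a\notin|M|$. For $M_0\leq_{\mathbf{K}}M$, $\mathbf{tp}(a/M,N)\upharpoonright_{M_0}=\mathbf{tp}(a/M_0,N)$; $q$ extends $p$ if $p$ is a restriction of $q$. $(a,M,N)\le(a,M',N')$ means $M\leq_{\mathbf{K}}M'$ and $N\leq_{\mathbf{K}}N'$. **Frames.** Let $\lambda<\mu$,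 $\lambda$ an infinite cardinal, $\mu$ an infinite cardinal or $\infty$. A *pre-$[\lambda,\mu)$-frame* is a triple $(\mathbf{K},\downarrow,\mathbf{S}^{bs})$ with: $\mathbf{K}$ an AEC, $\lambda\ge\mathrm{LS}(\mathbf{K})$, $\mathbf{K}_\lambda\neq\emptyset$; $\mathbf{S}^{bs}\subseteq\bigcup_{M\in\mathbf{K}_{[\lambda,\mu)}}\mathbf{S}^{na}(M)$, with $\mathbf{S}^{bs}(M)=\mathbf{S}(M)\cap\mathbf{S}^{bs}$; $\downarrow$ a relation on quadruples $(M_0,M_1,a,N)$ with $M_0\leq_{\mathbf{K}}M_1\leq_{\mathbf{K}}N$ in $\mathbf{K}_{[\lambda,\mu)}$, $a\in N$, written $a\downarrow_{M_0}^{N}M_1$ or "$\mathbf{tp}(a/M_1,N)$ does not fork over $M_0$"; satisfying Invariance (if $f:N\cong N'$ and $a\downarrow_{M_0}^N M_1$ then $f(a)\downarrow_{f[M_0]}^{N'}f[M_1]$; if $\mathbf{tp}(a/M_1,N)\in\mathbf{S}^{bs}(M_1)$ then $\mathbf{tp}(f(a)/f[M_1],N')\in\mathbf{S}^{bs}(f[M_1])$); Monotonicity (if $a\downarrow_{M_0}^N M_1$ and $M_0\leq_{\mathbf{K}}M_0'\leq_{\mathbf{K}}M_1'\leq_{\mathbf{K}}M_1\leq_{\mathbf{K}}N'\leq_{\mathbf{K}}N\leq_{\mathbf{K}}N''$ with $N''\in\mathbf{K}_{[\lambda,\mu)}$, $a\in N'$, then $a\downarrow_{M_0'}^{N'}M_1'$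 and $a\downarrow_{M_0'}^{N''}M_1'$); and: if $a\downarrow_M^N M$ then $\mathbf{tp}(a/M,N)\in\mathbf{S}^{bs}(M)$. A *w-good $[\lambda,\mu)$-frame* is a pre-$[\lambda,\mu)$-frame such that: - $\mathbf{K}_{[\lambda,\mu)}$ has amalgamation, joint embedding and no maximal models. - Weak density: if $M\in\mathbf{K}_\lambda$ and $M<_{\mathbf{K}}N\in\mathbf{K}_{[\lambda,\mu)}$, there are $a\in|N|\setminus|M|$ and $M'<_{\mathbf{K}}N'$ in $\mathbf{K}_{[\lambda,\mu)}$ with $a\in|N'|\setminus|M'|$, $\mathbf{tp}(a/M',N')\in\mathbf{S}^{bs}(M')$ and $(a,M,N)\le(a,M',N')$. - Existence of nonforking extension: if $p\in\mathbf{S}^{bs}(M)$ and $M\leq_{\mathbf{K}}N\in\mathbf{K}_{[\lambda,\mu)}$, some $q\in\mathbf{S}^{bs}(N)$ extends $p$ and does not fork over $M$. - Uniqueness: if $M\leq_{\mathbf{K}}N$ are in $\mathbf{K}_{[\lambda,\mu)}$, $p,q\in\mathbf{S}(N)$ do not fork over $M$ and $p\upharpoonright_M=q\upharpoonright_M$, then $p=q$. - Continuity: if $\delta<\mu$ is a limit ordinal, $\{M_i:i<\delta\}\subseteq\mathbf{K}_{[\lambda,\mu)}$ is increasing continuous, $M_\delta=\bigcup_{i<\delta}M_i$, $p_i\in\mathbf{S}^{bs}(M_i)$ with $p_i=p_j\upharpoonright_{M_i}$ for $i<j<\delta$, and $p\in\mathbf{S}^{na}(M_\delta)$ extends all $p_i$,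 then $p\in\mathbf{S}^{bs}(M_\delta)$; moreover if each $p_i$ does not fork over $M_0$, neither does $p$. *)

theory Defs
  imports Main
begin

unbundle cardinal_syntax

text \<open>
  The set-theoretic universe is represented by a type \<open>'u\<close>. A "set" is a subset of \<open>'u\<close> of
  cardinality smaller than \<open>'u\<close>, and a "proper class" of structures is a HOL set of
  structures whose underlying sets are sets in this sense. A cardinal (of the universe) is a cardinal
  order on \<open>'u\<close> that is strictly below \<open>|UNIV :: 'u set|\<close>, and an ordinal is a well-order on \<open>'u\<close>
  that is strictly below it; \<open>\<le>o\<close> and \<open><o\<close> compare well-orders by order type, and a cardinal order
  is an initial ordinal. The theorem assumes in addition that \<open>'u\<close> has regular cardinality, so that
  the union of a set of sets is a set, and, when \<open>\<mu>\<close> is a cardinal, that \<open>\<mu>\<^sup>+\<close> is still a cardinal of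
  the universe. For instance, any type of cardinality \<open>\<mu>\<^sup>+\<^sup>+\<close> will do.
\<close>

definition set_sized :: "'u set \<Rightarrow> bool" where
  "set_sized A \<longleftrightarrow> |A| <o |UNIV :: 'u set|"

definition infinite_cardinal :: "'u rel \<Rightarrow> bool" where
  "infinite_cardinal \<kappa> \<longleftrightarrow> Card_order \<kappa> \<and> infinite (Field \<kappa>) \<and> \<kappa> <o |UNIV :: 'u set|"

text \<open>A limit ordinal is nonzero here.\<close>

definition limit_ordinal :: "'i rel \<Rightarrow> bool" where
  "limit_ordinal r \<longleftrightarrow>
     Well_order r \<and> Field r \<noteq> {} \<and> (\<forall>i\<in>Field r. \<exists>j\<in>Field r. i \<noteq> j \<and> (i, j) \<in> r)"


section \<open>Structures\<close>

text \<open>Vocabularies are finitary; constants are function symbols of arity \<open>0\<close>.\<close>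

record ('f, 'r) vocab =
  fsyms :: "'f set"
  rsyms :: "'r set"
  far :: "'f \<Rightarrow> nat"
  rar :: "'r \<Rightarrow> nat"

record ('f, 'r, 'u) struct =
  univ :: "'u set"
  fint :: "'f \<Rightarrow> 'u list \<Rightarrow> 'u"
  rint :: "'r \<Rightarrow> 'u list set"

definition tuples :: "'u set \<Rightarrow> nat \<Rightarrow> 'u list set" where
  "tuples A n = {xs. set xs \<subseteq> A \<and> length xs = n}"

text \<open>
  Interpretations are required to take default values wherever they are irrelevant, so that HOL
  equality of structures is equality of structures.
\<close>

definition is_struct :: "('f, 'r) vocab \<Rightarrow> ('f, 'r, 'u) struct \<Rightarrow> bool" where
  "is_struct \<tau> M \<longleftrightarrow>
     set_sized (univ M) \<and>
     (\<forall>s\<in>fsyms \<tau>. \<forall>xs\<in>tuples (univ M) (far \<tau> s). fint M s xs \<in> univ M) \<and>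
     (\<forall>s xs. s \<notin> fsyms \<tau> \<or> xs \<notin> tuples (univ M) (far \<tau> s) \<longrightarrow> fint M s xs = undefined) \<and>
     (\<forall>R\<in>rsyms \<tau>. rint M R \<subseteq> tuples (univ M) (rar \<tau> R)) \<and>
     (\<forall>R. R \<notin> rsyms \<tau> \<longrightarrow> rint M R = {})"

definition substruct ::
    "('f, 'r) vocab \<Rightarrow> ('f, 'r, 'u) struct \<Rightarrow> ('f, 'r, 'u) struct \<Rightarrow> bool" where
  "substruct \<tau> M N \<longleftrightarrow>
     univ M \<subseteq> univ N \<and>
     (\<forall>s\<in>fsyms \<tau>. \<forall>xs\<in>tuples (univ M) (far \<tau> s). fint M s xs = fint N s xs) \<and>
     (\<forall>R\<in>rsyms \<tau>. rint M R = rint N R \<inter> tuples (univ M) (rar \<tau> R))"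

text \<open>Only the values of the map on \<open>univ M\<close> matter.\<close>

definition iso ::
    "('f, 'r) vocab \<Rightarrow> ('u \<Rightarrow> 'u) \<Rightarrow> ('f, 'r, 'u) struct \<Rightarrow> ('f, 'r, 'u) struct \<Rightarrow> bool" where
  "iso \<tau> f M N \<longleftrightarrow>
     is_struct \<tau> M \<and> is_struct \<tau> N \<and> bij_betw f (univ M) (univ N) \<and>
     (\<forall>s\<in>fsyms \<tau>. \<forall>xs\<in>tuples (univ M) (far \<tau> s). f (fint M s xs) = fint N s (map f xs)) \<and>
     (\<forall>R\<in>rsyms \<tau>. \<forall>xs\<in>tuples (univ M) (rar \<tau> R). xs \<in> rint M R \<longleftrightarrow> map f xs \<in> rint N R)"

text \<open>The structure \<open>f[M]\<close>, for \<open>f\<close> injective on the universe of \<open>M\<close>.\<close>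

definition img ::
    "('f, 'r) vocab \<Rightarrow> ('u \<Rightarrow> 'u) \<Rightarrow> ('f, 'r, 'u) struct \<Rightarrow> ('f, 'r, 'u) struct" where
  "img \<tau> f M =
     \<lparr> univ = f ` univ M,
       fint = (\<lambda>s ys. if s \<in> fsyms \<tau> \<and> ys \<in> tuples (f ` univ M) (far \<tau> s)
                      then f (fint M s (map (inv_into (univ M) f) ys)) else undefined),
       rint = (\<lambda>R. map f ` rint M R) \<rparr>"

text \<open>
  The union of a family that is directed under \<open>substruct\<close>: every tuple from the union lies in a
  member of the family, any two of which agree on it.
\<close>

definition union_struct ::
    "('f, 'r) vocab \<Rightarrow> 'i set \<Rightarrow> ('i \<Rightarrow> ('f, 'r, 'u) struct) \<Rightarrow> ('f, 'r, 'u) struct" where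
  "union_struct \<tau> I Ms =
     \<lparr> univ = (\<Union>i\<in>I. univ (Ms i)),
       fint = (\<lambda>s xs. if s \<in> fsyms \<tau> \<and> (\<exists>i\<in>I. xs \<in> tuples (univ (Ms i)) (far \<tau> s))
                      then fint (Ms (SOME i. i \<in> I \<and> xs \<in> tuples (univ (Ms i)) (far \<tau> s))) s xs
                      else undefined),
       rint = (\<lambda>R. \<Union>i\<in>I. rint (Ms i) R) \<rparr>"


section \<open>Abstract elementary classes and Galois types\<close>

type_synonym ('f, 'r, 'u) triple = "'u \<times> ('f, 'r, 'u) struct \<times> ('f, 'r, 'u) struct"

text \<open>A Galois type is an equivalence class of triples \<open>(a, M, N)\<close>.\<close>

type_synonym ('f, 'r, 'u) gtype = "('f, 'r, 'u) triple set"

locale structure_class =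
  fixes \<tau> :: "('f, 'r) vocab"
    and K :: "('f, 'r, 'u) struct set"
    and leq :: "('f, 'r, 'u) struct rel"
begin

abbreviation le_K (infix \<open>\<preceq>\<close> 50) where
  "M \<preceq> N \<equiv> (M, N) \<in> leq"

abbreviation less_K (infix \<open>\<prec>\<close> 50) where
  "M \<prec> N \<equiv> M \<preceq> N \<and> M \<noteq> N"

definition K_embedding where
  "K_embedding f M N \<longleftrightarrow> (\<exists>M'. iso \<tau> f M M' \<and> M' \<preceq> N)"

definition K_embedding_over where
  "K_embedding_over A f M N \<longleftrightarrow> K_embedding f M N \<and> (\<forall>x\<in>A. f x = x)"

definition chain :: "'i rel \<Rightarrow> ('i \<Rightarrow> ('f, 'r, 'u) struct) \<Rightarrow> bool" where
  "chain r Ms \<longleftrightarrow>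
     (\<forall>i\<in>Field r. Ms i \<in> K) \<and>
     (\<forall>i j. (i, j) \<in> r \<longrightarrow> Ms i \<preceq> Ms j) \<and>
     (\<forall>i\<in>Field r. limit_ordinal (Restr r (underS r i)) \<longrightarrow>
        Ms i = union_struct \<tau> (underS r i) Ms)"

definition LS_bound :: "'u rel \<Rightarrow> bool" where
  "LS_bound \<kappa> \<longleftrightarrow>
     infinite_cardinal \<kappa> \<and> |fsyms \<tau>| +c |rsyms \<tau>| \<le>o \<kappa> \<and>
     (\<forall>N\<in>K. \<forall>A \<subseteq> univ N. \<exists>M. M \<preceq> N \<and> A \<subseteq> univ M \<and> |univ M| \<le>o |A| +c \<kappa>)"

text \<open>\<open>LS\<close> is the least \<open>LS_bound\<close>, which is unique up to order isomorphism.\<close>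

definition LS :: "'u rel" where
  "LS = (SOME \<kappa>. LS_bound \<kappa> \<and> (\<forall>\<kappa>'. LS_bound \<kappa>' \<longrightarrow> \<kappa> \<le>o \<kappa>'))"

definition E_at :: "('f, 'r, 'u) triple rel" where
  "E_at = {((a0, M, N0), (a1, M', N1)) | a0 a1 M M' N0 N1.
     M = M' \<and> M \<preceq> N0 \<and> M \<preceq> N1 \<and> a0 \<in> univ N0 \<and> a1 \<in> univ N1 \<and>
     (\<exists>N\<in>K. \<exists>f0 f1. K_embedding_over (univ M) f0 N0 N \<and> K_embedding_over (univ M) f1 N1 N \<and>
        f0 a0 = f1 a1)}"

definition tp :: "'u \<Rightarrow> ('f, 'r, 'u) struct \<Rightarrow> ('f, 'r, 'u) struct \<Rightarrow> ('f, 'r, 'u) gtype" where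
  "tp a M N = E_at\<^sup>+ `` {(a, M, N)}"

definition S :: "('f, 'r, 'u) struct \<Rightarrow> ('f, 'r, 'u) gtype set" where
  "S M = {tp a M N | a N. M \<preceq> N \<and> a \<in> univ N}"

definition S_na :: "('f, 'r, 'u) struct \<Rightarrow> ('f, 'r, 'u) gtype set" where
  "S_na M = {tp a M N | a N. M \<preceq> N \<and> a \<in> univ N \<and> a \<notin> univ M}"

text \<open>
  The restriction of \<open>p \<in> S M\<close> to \<open>M0 \<preceq> M\<close>; the classes in the union all coincide. A type \<open>q\<close>
  extends \<open>p \<in> S M0\<close> iff \<open>restr q M0 = p\<close>.
\<close>

definition restr :: "('f, 'r, 'u) gtype \<Rightarrow> ('f, 'r, 'u) struct \<Rightarrow> ('f, 'r, 'u) gtype" where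
  "restr p M0 = (\<Union>(a, M, N)\<in>p. tp a M0 N)"

definition amalgamation :: "('f, 'r, 'u) struct set \<Rightarrow> bool" where
  "amalgamation L \<longleftrightarrow>
     (\<forall>M\<in>L. \<forall>N\<in>L. \<forall>R\<in>L. M \<preceq> N \<and> M \<preceq> R \<longrightarrow>
        (\<exists>R'\<in>K. R \<preceq> R' \<and> (\<exists>f. K_embedding_over (univ M) f N R')))"

definition joint_embedding :: "('f, 'r, 'u) struct set \<Rightarrow> bool" where
  "joint_embedding L \<longleftrightarrow>
     (\<forall>M\<in>L. \<forall>N\<in>L. \<exists>R'\<in>K. N \<preceq> R' \<and> (\<exists>f. K_embedding f M R'))"

definition no_maximal_models :: "('f, 'r, 'u) struct set \<Rightarrow> bool" where
  "no_maximal_models L \<longleftrightarrow> (\<forall>M\<in>L. \<exists>M'\<in>K. M \<prec> M')"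

definition K_card :: "'u rel \<Rightarrow> ('f, 'r, 'u) struct set" where
  "K_card \<kappa> = {M \<in> K. |univ M| =o \<kappa>}"

end

locale aec = structure_class \<tau> K leq
  for \<tau> :: "('f, 'r) vocab"
    and K :: "('f, 'r, 'u) struct set"
    and leq :: "('f, 'r, 'u) struct rel" +
  assumes structs: "M \<in> K \<Longrightarrow> is_struct \<tau> M"
    and partial_order: "partial_order_on K leq"
    and K_iso: "M \<in> K \<Longrightarrow> iso \<tau> f M N \<Longrightarrow> N \<in> K"
    and leq_iso: "(M, N) \<in> leq \<Longrightarrow> iso \<tau> f N N' \<Longrightarrow> (img \<tau> f M, N') \<in> leq"
    and leq_substruct: "(M, N) \<in> leq \<Longrightarrow> substruct \<tau> M N"
    and coherence:
      "(M0, M2) \<in> leq \<Longrightarrow> (M1, M2) \<in> leq \<Longrightarrow> substruct \<tau> M0 M1 \<Longrightarrow> (M0, M1) \<in> leq"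
    and union_in_K:
      "limit_ordinal (r :: 'u rel) \<Longrightarrow> r <o |UNIV :: 'u set| \<Longrightarrow> chain r Ms \<Longrightarrow>
         union_struct \<tau> (Field r) Ms \<in> K"
    and union_upper:
      "limit_ordinal (r :: 'u rel) \<Longrightarrow> r <o |UNIV :: 'u set| \<Longrightarrow> chain r Ms \<Longrightarrow> i \<in> Field r \<Longrightarrow>
         (Ms i, union_struct \<tau> (Field r) Ms) \<in> leq"
    and union_least:
      "limit_ordinal (r :: 'u rel) \<Longrightarrow> r <o |UNIV :: 'u set| \<Longrightarrow> chain r Ms \<Longrightarrow> N \<in> K \<Longrightarrow>
         (\<And>i. i \<in> Field r \<Longrightarrow> (Ms i, N) \<in> leq) \<Longrightarrow> (union_struct \<tau> (Field r) Ms, N) \<in> leq"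
    and LS_exists: "\<exists>\<kappa>. LS_bound \<kappa>"


section \<open>Frames\<close>

text \<open>
  The upper bound \<open>\<mu>\<close> of an interval of cardinals is \<open>Some m\<close> for a cardinal \<open>m\<close>, and \<open>None\<close>
  for \<open>\<infinity>\<close>.
\<close>

definition less_bound :: "'v rel \<Rightarrow> 'u rel option \<Rightarrow> bool" where
  "less_bound r \<mu> \<longleftrightarrow> (case \<mu> of None \<Rightarrow> r <o |UNIV :: 'u set| | Some m \<Rightarrow> r <o m)"

definition le_succ_bound :: "'v rel \<Rightarrow> 'u rel option \<Rightarrow> bool" where
  "le_succ_bound \<kappa> \<mu> \<longleftrightarrow>
     (case \<mu> of None \<Rightarrow> \<kappa> <o |UNIV :: 'u set| | Some m \<Rightarrow> \<kappa> \<le>o cardSuc m)"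

locale frame_data = structure_class \<tau> K leq
  for \<tau> :: "('f, 'r) vocab"
    and K :: "('f, 'r, 'u) struct set"
    and leq :: "('f, 'r, 'u) struct rel" +
  fixes lam :: "'u rel"
    and \<mu> :: "'u rel option"
    and nf :: "('f, 'r, 'u) struct \<Rightarrow> ('f, 'r, 'u) struct \<Rightarrow> 'u \<Rightarrow> ('f, 'r, 'u) struct \<Rightarrow> bool"
      \<comment> \<open>\<open>nf M0 M1 a N\<close>: the type of \<open>a\<close> over \<open>M1\<close> in \<open>N\<close> does not fork over \<open>M0\<close>\<close>
    and Sbs :: "('f, 'r, 'u) gtype set"
begin

definition K_int :: "('f, 'r, 'u) struct set" where
  "K_int = {M \<in> K. lam \<le>o |univ M| \<and> less_bound |univ M| \<mu>}"

definition S_bs :: "('f, 'r, 'u) struct \<Rightarrow> ('f, 'r, 'u) gtype set" where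
  "S_bs M = S M \<inter> Sbs"

definition does_not_fork_over :: "('f, 'r, 'u) gtype \<Rightarrow> ('f, 'r, 'u) struct \<Rightarrow> bool" where
  "does_not_fork_over p M0 \<longleftrightarrow> (\<exists>a M1 N. p = tp a M1 N \<and> nf M0 M1 a N)"

end

locale pre_frame = frame_data \<tau> K leq lam \<mu> nf Sbs + aec \<tau> K leq
  for \<tau> :: "('f, 'r) vocab"
    and K :: "('f, 'r, 'u) struct set"
    and leq :: "('f, 'r, 'u) struct rel"
    and lam :: "'u rel"
    and \<mu> :: "'u rel option"
    and nf :: "('f, 'r, 'u) struct \<Rightarrow> ('f, 'r, 'u) struct \<Rightarrow> 'u \<Rightarrow> ('f, 'r, 'u) struct \<Rightarrow> bool"
    and Sbs :: "('f, 'r, 'u) gtype set" +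
  assumes lambda_cardinal: "infinite_cardinal lam"
    and mu_cardinal: "\<mu> = Some m \<Longrightarrow> infinite_cardinal m"
    and lambda_less_mu: "less_bound lam \<mu>"
    and LS_le_lambda: "LS \<le>o lam"
    and K_lambda_nonempty: "K_card lam \<noteq> {}"
    and Sbs_nonalgebraic: "Sbs \<subseteq> (\<Union>M\<in>K_int. S_na M)"
    and nf_domain: "nf M0 M1 a N \<Longrightarrow>
      M0 \<in> K_int \<and> M1 \<in> K_int \<and> N \<in> K_int \<and> M0 \<preceq> M1 \<and> M1 \<preceq> N \<and> a \<in> univ N"
    and nf_invariance: "iso \<tau> f N N' \<Longrightarrow> nf M0 M1 a N \<Longrightarrow> nf (img \<tau> f M0) (img \<tau> f M1) (f a) N'"
    and Sbs_invariance:
      "iso \<tau> f N N' \<Longrightarrow> M1 \<preceq> N \<Longrightarrow> a \<in> univ N \<Longrightarrow> tp a M1 N \<in> S_bs M1 \<Longrightarrow>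
         tp (f a) (img \<tau> f M1) N' \<in> S_bs (img \<tau> f M1)"
    and nf_monotonicity:
      "nf M0 M1 a N \<Longrightarrow> M0 \<preceq> M0' \<Longrightarrow> M0' \<preceq> M1' \<Longrightarrow> M1' \<preceq> M1 \<Longrightarrow> M1 \<preceq> N' \<Longrightarrow> N' \<preceq> N \<Longrightarrow>
         N \<preceq> N'' \<Longrightarrow> N'' \<in> K_int \<Longrightarrow> a \<in> univ N' \<Longrightarrow> nf M0' M1' a N' \<and> nf M0' M1' a N''"
    and nf_basic: "nf M M a N \<Longrightarrow> tp a M N \<in> S_bs M"

text \<open>
  In the continuity axioms, \<open>\<mu>\<close> may be singular, in which case a union of fewer than \<open>\<mu>\<close> models
  of cardinality below \<open>\<mu>\<close> may have cardinality \<open>\<mu>\<close>. Basic types and nonforking are only defined over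
  models in the interval, so the union is required to be one of them.
\<close>

locale w_good_frame = pre_frame \<tau> K leq lam \<mu> nf Sbs
  for \<tau> :: "('f, 'r) vocab"
    and K :: "('f, 'r, 'u) struct set"
    and leq :: "('f, 'r, 'u) struct rel"
    and lam :: "'u rel"
    and \<mu> :: "'u rel option"
    and nf :: "('f, 'r, 'u) struct \<Rightarrow> ('f, 'r, 'u) struct \<Rightarrow> 'u \<Rightarrow> ('f, 'r, 'u) struct \<Rightarrow> bool"
    and Sbs :: "('f, 'r, 'u) gtype set" +
  assumes amalgamation: "amalgamation K_int"
    and joint_embedding: "joint_embedding K_int"
    and no_maximal_models: "no_maximal_models K_int"
    and weak_density:
      "M \<in> K_card lam \<Longrightarrow> N \<in> K_int \<Longrightarrow> M \<prec> N \<Longrightarrow>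
         \<exists>a M' N'. a \<in> univ N - univ M \<and> M' \<in> K_int \<and> N' \<in> K_int \<and> M' \<prec> N' \<and>
           a \<in> univ N' - univ M' \<and> tp a M' N' \<in> S_bs M' \<and> M \<preceq> M' \<and> N \<preceq> N'"
    and nonforking_extension:
      "p \<in> S_bs M \<Longrightarrow> M \<preceq> N \<Longrightarrow> N \<in> K_int \<Longrightarrow>
         \<exists>q\<in>S_bs N. restr q M = p \<and> does_not_fork_over q M"
    and uniqueness:
      "M \<in> K_int \<Longrightarrow> N \<in> K_int \<Longrightarrow> M \<preceq> N \<Longrightarrow> p \<in> S N \<Longrightarrow> q \<in> S N \<Longrightarrow>
         does_not_fork_over p M \<Longrightarrow> does_not_fork_over q M \<Longrightarrow> restr p M = restr q M \<Longrightarrow> p = q"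
    and continuity:
      "limit_ordinal (r :: 'u rel) \<Longrightarrow> less_bound r \<mu> \<Longrightarrow> chain r Ms \<Longrightarrow>
         (\<And>i. i \<in> Field r \<Longrightarrow> Ms i \<in> K_int) \<Longrightarrow> M\<delta> = union_struct \<tau> (Field r) Ms \<Longrightarrow> M\<delta> \<in> K_int \<Longrightarrow>
         (\<And>i. i \<in> Field r \<Longrightarrow> ps i \<in> S_bs (Ms i)) \<Longrightarrow>
         (\<And>i j. (i, j) \<in> r \<Longrightarrow> i \<noteq> j \<Longrightarrow> ps i = restr (ps j) (Ms i)) \<Longrightarrow>
         p \<in> S_na M\<delta> \<Longrightarrow> (\<And>i. i \<in> Field r \<Longrightarrow> restr p (Ms i) = ps i) \<Longrightarrow>
         p \<in> S_bs M\<delta>"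
    and continuity_nonforking:
      "limit_ordinal (r :: 'u rel) \<Longrightarrow> less_bound r \<mu> \<Longrightarrow> chain r Ms \<Longrightarrow>
         (\<And>i. i \<in> Field r \<Longrightarrow> Ms i \<in> K_int) \<Longrightarrow> M\<delta> = union_struct \<tau> (Field r) Ms \<Longrightarrow> M\<delta> \<in> K_int \<Longrightarrow>
         (\<And>i. i \<in> Field r \<Longrightarrow> ps i \<in> S_bs (Ms i)) \<Longrightarrow>
         (\<And>i j. (i, j) \<in> r \<Longrightarrow> i \<noteq> j \<Longrightarrow> ps i = restr (ps j) (Ms i)) \<Longrightarrow>
         p \<in> S_na M\<delta> \<Longrightarrow> (\<And>i. i \<in> Field r \<Longrightarrow> restr p (Ms i) = ps i) \<Longrightarrow>
         z \<in> Field r \<Longrightarrow> (\<And>i. i \<in> Field r \<Longrightarrow> (z, i) \<in> r) \<Longrightarrow>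
         (\<And>i. i \<in> Field r \<Longrightarrow> does_not_fork_over (ps i) (Ms z)) \<Longrightarrow>
         does_not_fork_over p (Ms z)"

end

theory Submission
  imports Defs
begin

text \<open>
  If every model of size at least \<open>\<lambda>\<close> and below \<open>\<kappa>\<close> has a proper extension, then a strictly
  increasing continuous chain of length \<open>\<kappa>\<close>, whose members are kept small with the
  Lowenheim-Skolem property, has a union of size \<open>\<kappa>\<close> (\<open>exists_model_of_card\<close>). For \<open>\<kappa> \<le> \<mu>\<^sup>+\<close> the
  models in question have size below \<open>\<mu>\<close> or equal to \<open>\<mu>\<close>. Below \<open>\<mu>\<close>, and always if \<open>\<mu> = \<infinity>\<close>, there
  are proper extensions because \<open>K_int\<close> has no maximal models.
  So the point is that a model \<open>M\<close> of size \<open>\<mu>\<close> is not maximal (\<open>no_maximal_model_of_card_bound\<close>).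

  Write \<open>M\<close> as the union of a continuous chain of models \<open>M\<^sub>i\<close>, \<open>i < \<mu>\<close>, of size below \<open>\<mu>\<close>
  (\<open>resolution_into_chain\<close>), and let \<open>N\<^sub>0\<close> be an extension of \<open>M\<^sub>0\<close> of size below \<open>\<mu>\<close>. By amalgamation,
  one builds an increasing continuous chain of models \<open>N\<^sub>i\<close> and increasing embeddings
  \<open>f\<^sub>i : M\<^sub>i \<rightarrow> N\<^sub>i\<close> with \<open>f\<^sub>0\<close> the identity; in the limit, \<open>M\<close> embeds into an extension of \<open>N\<^sub>0\<close>
  (\<open>amalgamation_along_chain\<close>). This is used twice.

  First, without further constraints: if \<open>M\<close> is maximal, then it contains a copy of \<open>N\<^sub>0\<close>, for every such
  \<open>N\<^sub>0\<close>. By weak density, some \<open>N\<^sub>0\<close> carries a basic type. Hence \<open>M\<close> has a submodel of size below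
  \<open>\<mu>\<close> over which there is a basic type.

  Second, with that submodel as \<open>M\<^sub>0\<close> and with some \<open>a \<in> N\<^sub>0\<close> that realizes the basic type: the chain can
  be built in such a way that the type of \<open>a\<close> over \<open>f\<^sub>i[M\<^sub>i]\<close> in \<open>N\<^sub>i\<close> remains basic. At successors,
  take a nonforking extension of the type to a copy of \<open>M\<^sub>i\<^sub>+\<^sub>1\<close> and amalgamate so that its realization
  is identified with \<open>a\<close> (\<open>amalgamation_of_basic_type\<close>); at limits, use continuity. Basic types are
  not algebraic, so \<open>a\<close> is never in \<open>f\<^sub>i[M\<^sub>i]\<close>, hence not in the image of \<open>M\<close>
  (\<open>basic_type_omitted\<close>). So \<open>M\<close> has a proper extension after all.
\<close>


section \<open>Permutations of the universe\<close>

lemma card_of_Diff_infinite: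
  assumes inf: "infinite A" and B: "|B| <o |A|"
  shows "|A - B| =o |A|"
proof -
  have "\<not> |A - B| <o |A|"
  proof
    assume "|A - B| <o |A|"
    then have "|(A - B) \<union> B| <o |A|"
      by (rule card_of_Un_ordLess_infinite[OF inf _ B])
    moreover have "|A| \<le>o |(A - B) \<union> B|" by (rule card_of_mono1) auto
    ultimately show False using not_ordLess_ordLeq by blast
  qed
  then show ?thesis
    by (meson Diff_subset card_of_mono1 ordLeq_iff_ordLess_or_ordIso)
qed

lemma set_sized_image: "set_sized A \<Longrightarrow> set_sized (f ` A)" for f :: "'u \<Rightarrow> 'u"
  unfolding set_sized_def by (rule ordLeq_ordLess_trans[OF card_of_image])

lemma infinite_cardinal_UNIV:
  "infinite_cardinal (k :: 'u rel) \<Longrightarrow> infinite (UNIV :: 'u set)"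
  unfolding infinite_cardinal_def by (auto dest: finite_subset[OF subset_UNIV])

text \<open>
  Copies of a model that extend a given copy of a submodel need fresh elements. A set has a
  complement as large as the universe, so the fresh elements can be provided once and for all by
  working with permutations of the universe.
\<close>

lemma permutation_extending:
  fixes f :: "'u \<Rightarrow> 'u"
  assumes inf: "infinite (UNIV :: 'u set)" and X: "set_sized X" and f: "inj_on f X"
  shows "\<exists>\<pi>. bij \<pi> \<and> (\<forall>x\<in>X. \<pi> x = f x)"
proof -
  have "|UNIV - X| =o |UNIV :: 'u set|"
    using X inf by (auto simp: set_sized_def intro: card_of_Diff_infinite)
  moreover have "|UNIV - f ` X| =o |UNIV :: 'u set|"
    using set_sized_image[OF X] inf by (auto simp: set_sized_def intro: card_of_Diff_infinite)
  ultimately have "|UNIV - X| =o |UNIV - f ` X|"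
    by (rule ordIso_transitive[OF _ ordIso_symmetric])
  then obtain g where g: "bij_betw g (UNIV - X) (UNIV - f ` X)"
    using card_of_ordIso by blast
  have "bij_betw (\<lambda>x. if x \<in> X then f x else g x) (X \<union> (UNIV - X)) (f ` X \<union> (UNIV - f ` X))"
    by (rule bij_betw_disjoint_Un) (use f g in \<open>auto simp: inj_on_imp_bij_betw\<close>)
  then have "bij (\<lambda>x. if x \<in> X then f x else g x)" by simp
  then show ?thesis by (intro exI[of _ "\<lambda>x. if x \<in> X then f x else g x"]) auto
qed


section \<open>Isomorphic copies and unions of structures\<close>

lemma tuples_image: "tuples (f ` A) n = map f ` tuples A n"
proof (intro equalityI subsetI)
  fix ys assume "ys \<in> tuples (f ` A) n"
  then have ys: "set ys \<subseteq> f ` A" "length ys = n" by (auto simp: tuples_def)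
  have "map (inv_into A f) ys \<in> tuples A n"
    using ys inv_into_into[of _ f A] by (auto simp: tuples_def)
  moreover have "map f (map (inv_into A f) ys) = ys"
    unfolding map_map by (rule map_idI) (use ys f_inv_into_f[of _ f A] in \<open>auto\<close>)
  ultimately show "ys \<in> map f ` tuples A n" by (metis imageI)
qed (auto simp: tuples_def; blast)

lemma map_in_tuples: "xs \<in> tuples A n \<Longrightarrow> map f xs \<in> tuples (f ` A) n"
  by (auto simp: tuples_image)

lemma tuples_mono: "A \<subseteq> B \<Longrightarrow> tuples A n \<subseteq> tuples B n"
  by (auto simp: tuples_def)

lemma map_eq_on_tuples: "xs \<in> tuples A n \<Longrightarrow> (\<And>x. x \<in> A \<Longrightarrow> f x = g x) \<Longrightarrow> map f xs = map g xs"
  by (auto simp: tuples_def)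

lemma map_inv_into_tuples:
  "inj_on f A \<Longrightarrow> xs \<in> tuples A n \<Longrightarrow> map (inv_into A f) (map f xs) = xs"
  unfolding map_map by (rule map_idI) (auto simp: tuples_def)

lemma fint_closed:
  "is_struct \<tau> M \<Longrightarrow> s \<in> fsyms \<tau> \<Longrightarrow> xs \<in> tuples (univ M) (far \<tau> s) \<Longrightarrow> fint M s xs \<in> univ M"
  by (auto simp: is_struct_def)

lemma rint_tuples:
  "is_struct \<tau> M \<Longrightarrow> xs \<in> rint M R \<Longrightarrow> R \<in> rsyms \<tau> \<and> xs \<in> tuples (univ M) (rar \<tau> R)"
  by (auto simp: is_struct_def)

lemma img_simps [simp]: "univ (img \<tau> f M) = f ` univ M"
  by (simp add: img_def)

lemma img_cong:
  assumes M: "is_struct \<tau> M" and eq: "\<And>x. x \<in> univ M \<Longrightarrow> f x = g x"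
  shows "img \<tau> f M = img \<tau> g M"
proof -
  have im: "f ` univ M = g ` univ M" using eq by auto
  have inv: "inv_into (univ M) f y = inv_into (univ M) g y" for y
    unfolding inv_into_def using eq by (metis (no_types, lifting))
  have "map f ` rint M R = map g ` rint M R" for R
  proof (rule image_cong[OF refl])
    fix xs assume "xs \<in> rint M R"
    then show "map f xs = map g xs"
      using rint_tuples[OF M] map_eq_on_tuples eq by metis
  qed
  moreover have "f (fint M s (map (inv_into (univ M) f) ys)) = g (fint M s (map (inv_into (univ M) g) ys))"
    if "s \<in> fsyms \<tau>" "ys \<in> tuples (g ` univ M) (far \<tau> s)" for s ys
  proof -
    have "map (inv_into (univ M) g) ys \<in> tuples (univ M) (far \<tau> s)"
      using that by (auto simp: tuples_def inv_into_into)
    then show ?thesis using eq[OF fint_closed[OF M that(1)]] by (simp add: inv cong: map_cong)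
  qed
  ultimately show ?thesis unfolding img_def im by (auto intro!: ext)
qed

lemma iso_img:
  assumes M: "is_struct \<tau> M" and f: "inj_on f (univ M)"
  shows "iso \<tau> f M (img \<tau> f M)"
proof -
  have fint: "fint (img \<tau> f M) s (map f xs) = f (fint M s xs)"
    if "s \<in> fsyms \<tau>" "xs \<in> tuples (univ M) (far \<tau> s)" for s xs
    using that map_in_tuples[OF that(2), of f] map_inv_into_tuples[OF f that(2)]
    by (simp add: img_def del: map_map)
  have "is_struct \<tau> (img \<tau> f M)"
    unfolding is_struct_def
  proof (intro conjI ballI allI impI)
    show "set_sized (univ (img \<tau> f M))" using M by (simp add: is_struct_def set_sized_image)
  next
    fix s xs assume s: "s \<in> fsyms \<tau>" "xs \<in> tuples (univ (img \<tau> f M)) (far \<tau> s)"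
    then obtain ys where "ys \<in> tuples (univ M) (far \<tau> s)" "xs = map f ys"
      by (auto simp: tuples_image)
    then show "fint (img \<tau> f M) s xs \<in> univ (img \<tau> f M)"
      using s fint fint_closed[OF M] by auto
  next
    fix s xs assume "s \<notin> fsyms \<tau> \<or> xs \<notin> tuples (univ (img \<tau> f M)) (far \<tau> s)"
    then show "fint (img \<tau> f M) s xs = undefined" by (auto simp: img_def)
  next
    fix R assume "R \<in> rsyms \<tau>"
    then show "rint (img \<tau> f M) R \<subseteq> tuples (univ (img \<tau> f M)) (rar \<tau> R)"
      using M by (auto simp: img_def is_struct_def intro!: map_in_tuples)
  next
    fix R assume "R \<notin> rsyms \<tau>"
    then show "rint (img \<tau> f M) R = {}" using M by (auto simp: img_def is_struct_def)
  qed
  moreover have "xs \<in> rint M R \<longleftrightarrow> map f xs \<in> rint (img \<tau> f M) R"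
    if R: "R \<in> rsyms \<tau>" and xs: "xs \<in> tuples (univ M) (rar \<tau> R)" for R xs
  proof
    assume "map f xs \<in> rint (img \<tau> f M) R"
    then obtain ys where ys: "ys \<in> rint M R" "map f ys = map f xs" by (auto simp: img_def)
    then have "ys = xs"
      using rint_tuples[OF M ys(1)] xs map_inv_into_tuples[OF f] by metis
    then show "xs \<in> rint M R" using ys by simp
  qed (auto simp: img_def)
  ultimately show ?thesis
    using M f fint by (auto simp: iso_def bij_betw_def)
qed

lemma struct_eqI:
  fixes M N :: "('f, 'r, 'u) struct"
  assumes M: "is_struct \<tau> M" and N: "is_struct \<tau> N" and eq: "univ M = univ N"
    and f: "\<And>s xs. s \<in> fsyms \<tau> \<Longrightarrow> xs \<in> tuples (univ M) (far \<tau> s) \<Longrightarrow> fint M s xs = fint N s xs"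
    and r: "\<And>R xs. R \<in> rsyms \<tau> \<Longrightarrow> xs \<in> tuples (univ M) (rar \<tau> R) \<Longrightarrow> xs \<in> rint M R \<longleftrightarrow> xs \<in> rint N R"
  shows "M = N"
proof -
  have "fint M s xs = fint N s xs" for s xs
    using M N eq f by (cases "s \<in> fsyms \<tau> \<and> xs \<in> tuples (univ M) (far \<tau> s)") (auto simp: is_struct_def)
  moreover have "rint M R = rint N R" for R
  proof (rule set_eqI)
    fix xs show "xs \<in> rint M R \<longleftrightarrow> xs \<in> rint N R"
      using rint_tuples[OF M, of xs R] rint_tuples[OF N, of xs R] r[of R xs] eq by auto
  qed
  ultimately show ?thesis using eq by (intro struct.equality) auto
qed

lemma substruct_eqI:
  "is_struct \<tau> M \<Longrightarrow> is_struct \<tau> N \<Longrightarrow> substruct \<tau> M N \<Longrightarrow> univ M = univ N \<Longrightarrow> M = N"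
  by (rule struct_eqI) (auto simp: substruct_def)

lemma iso_imp_eq_img:
  assumes "iso \<tau> f M N"
  shows "N = img \<tau> f M"
proof -
  have M: "is_struct \<tau> M" and N: "is_struct \<tau> N" and bij: "bij_betw f (univ M) (univ N)"
    using assms by (auto simp: iso_def)
  have img: "iso \<tau> f M (img \<tau> f M)"
    using iso_img[OF M] bij by (auto simp: bij_betw_def)
  have eq: "univ N = f ` univ M" using bij by (auto simp: bij_betw_def)
  show ?thesis
    using assms img by (intro struct_eqI[OF N]) (auto simp: iso_def eq tuples_image)
qed

lemma iso_comp:
  assumes f: "iso \<tau> f M N" and g: "iso \<tau> g N R"
  shows "iso \<tau> (g \<circ> f) M R"
proof -
  have eq: "univ N = f ` univ M" using f by (auto simp: iso_def bij_betw_def)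
  have "fint R s (map (g \<circ> f) xs) = g (f (fint M s xs))"
    if "s \<in> fsyms \<tau>" "xs \<in> tuples (univ M) (far \<tau> s)" for s xs
  proof -
    have "map f xs \<in> tuples (univ N) (far \<tau> s)" unfolding eq by (rule map_in_tuples[OF that(2)])
    then have "g (fint N s (map f xs)) = fint R s (map g (map f xs))"
      using g that(1) by (simp add: iso_def del: map_map)
    moreover have "f (fint M s xs) = fint N s (map f xs)" using f that by (simp add: iso_def)
    ultimately show ?thesis by simp
  qed
  moreover have "xs \<in> rint M S \<longleftrightarrow> map (g \<circ> f) xs \<in> rint R S"
    if "S \<in> rsyms \<tau>" "xs \<in> tuples (univ M) (rar \<tau> S)" for S xs
  proof -
    have "map f xs \<in> tuples (univ N) (rar \<tau> S)" unfolding eq by (rule map_in_tuples[OF that(2)])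
    then have "map f xs \<in> rint N S \<longleftrightarrow> map g (map f xs) \<in> rint R S"
      using g that(1) by (simp add: iso_def del: map_map)
    moreover have "xs \<in> rint M S \<longleftrightarrow> map f xs \<in> rint N S" using f that by (simp add: iso_def)
    ultimately show ?thesis by simp
  qed
  ultimately show ?thesis
    using f g by (auto simp: iso_def intro: bij_betw_trans)
qed

lemma img_comp:
  assumes M: "is_struct \<tau> M" and f: "inj_on f (univ M)" and g: "inj_on g (f ` univ M)"
  shows "img \<tau> g (img \<tau> f M) = img \<tau> (g \<circ> f) M"
proof -
  have 1: "iso \<tau> f M (img \<tau> f M)" by (rule iso_img[OF M f])
  then have "iso \<tau> g (img \<tau> f M) (img \<tau> g (img \<tau> f M))"
    using g by (intro iso_img) (auto simp: iso_def)
  from iso_imp_eq_img[OF iso_comp[OF 1 this]] show ?thesis .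
qed

lemma img_ident:
  assumes M: "is_struct \<tau> M" and f: "\<And>x. x \<in> univ M \<Longrightarrow> f x = x"
  shows "img \<tau> f M = M"
proof -
  have "iso \<tau> f M M"
    unfolding iso_def
  proof (intro conjI ballI)
    show "bij_betw f (univ M) (univ M)" using f by (auto simp: bij_betw_def inj_on_def)
    fix s xs assume "s \<in> fsyms \<tau>" "xs \<in> tuples (univ M) (far \<tau> s)"
    then show "f (fint M s xs) = fint M s (map f xs)"
      using f fint_closed[OF M] map_eq_on_tuples[of xs _ _ f id] by simp
  next
    fix R xs assume "R \<in> rsyms \<tau>" "xs \<in> tuples (univ M) (rar \<tau> R)"
    then show "xs \<in> rint M R \<longleftrightarrow> map f xs \<in> rint M R"
      using f map_eq_on_tuples[of xs _ _ f id] by simp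
  qed (use M in auto)
  from iso_imp_eq_img[OF this] show ?thesis by simp
qed

lemma univ_union_struct [simp]: "univ (union_struct \<tau> I Ms) = (\<Union>i\<in>I. univ (Ms i))"
  by (simp add: union_struct_def)

lemma union_struct_cong:
  assumes "\<And>i. i \<in> I \<Longrightarrow> Ms i = Ns i"
  shows "union_struct \<tau> I Ms = union_struct \<tau> I Ns"
proof -
  have "(i \<in> I \<and> xs \<in> tuples (univ (Ms i)) n) = (i \<in> I \<and> xs \<in> tuples (univ (Ns i)) n)" for i xs n
    using assms by auto
  moreover have "(SOME i. i \<in> I \<and> xs \<in> tuples (univ (Ns i)) n) \<in> I"
    if "\<exists>i\<in>I. xs \<in> tuples (univ (Ns i)) n" for xs n
    using that by (metis (mono_tags, lifting) someI_ex)
  ultimately show ?thesis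
    unfolding union_struct_def using assms by (auto intro!: ext)
qed

text \<open>
  A structure with enough substructures is their union. Identities between unions then need no
  computation with the interpretations: only universes have to be compared.
\<close>

lemma union_struct_eqI:
  assumes N: "is_struct \<tau> N" and X: "\<And>i. i \<in> I \<Longrightarrow> is_struct \<tau> (X i)"
    and sub: "\<And>i. i \<in> I \<Longrightarrow> substruct \<tau> (X i) N"
    and directed: "\<And>F. finite F \<Longrightarrow> F \<subseteq> univ N \<Longrightarrow> \<exists>i\<in>I. F \<subseteq> univ (X i)"
  shows "union_struct \<tau> I X = N"
proof -
  have le: "univ (X i) \<subseteq> univ N" if "i \<in> I" for i using sub[OF that] by (simp add: substruct_def)
  have eq: "(\<Union>i\<in>I. univ (X i)) = univ N"
    using le directed[of "{x}" for x] by fastforce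
  have tup: "\<exists>i\<in>I. xs \<in> tuples (univ (X i)) n" if "xs \<in> tuples (univ N) n" for xs n
    using directed[of "set xs"] that by (auto simp: tuples_def)
  have "fint (union_struct \<tau> I X) s xs = fint N s xs" for s xs
  proof (cases "s \<in> fsyms \<tau> \<and> xs \<in> tuples (univ N) (far \<tau> s)")
    case True
    let ?i = "SOME i. i \<in> I \<and> xs \<in> tuples (univ (X i)) (far \<tau> s)"
    have ex: "\<exists>i\<in>I. xs \<in> tuples (univ (X i)) (far \<tau> s)" using tup True by blast
    have i: "?i \<in> I \<and> xs \<in> tuples (univ (X ?i)) (far \<tau> s)"
      by (rule someI_ex[OF ex[unfolded Bex_def]])
    then have "fint (X ?i) s xs = fint N s xs"
      using sub[of ?i] True unfolding substruct_def by blast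
    then show ?thesis using True ex by (simp add: union_struct_def)
  next
    case False
    then have "\<not> (s \<in> fsyms \<tau> \<and> (\<exists>i\<in>I. xs \<in> tuples (univ (X i)) (far \<tau> s)))"
      using le tuples_mono by blast
    then show ?thesis using False N by (auto simp: union_struct_def is_struct_def)
  qed
  moreover have "rint (union_struct \<tau> I X) R = rint N R" for R
  proof (cases "R \<in> rsyms \<tau>")
    case True
    then have "rint (X i) R = rint N R \<inter> tuples (univ (X i)) (rar \<tau> R)" if "i \<in> I" for i
      using sub[OF that] by (simp add: substruct_def)
    then show ?thesis using tup rint_tuples[OF N] by (fastforce simp: union_struct_def)
  next
    case False
    then show ?thesis using X N by (auto simp: union_struct_def is_struct_def)
  qed
  ultimately show ?thesis using eq by (intro struct.equality) auto
qed


section \<open>Chains built by transfinite recursion\<close>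

lemma Field_Restr_underS: "Well_order r \<Longrightarrow> Field (Restr r (underS r i)) = underS r i"
  by (rule Refl_Field_Restr2) (auto simp: order_on_defs underS_Field)

lemma underS_mono: "Well_order r \<Longrightarrow> (j, i) \<in> r \<Longrightarrow> underS r j \<subseteq> underS r i"
  by (simp add: order_on_defs underS_incr)

lemma underS_memD: "j \<in> underS r i \<Longrightarrow> (j, i) \<in> r \<and> j \<noteq> i"
  by (simp add: underS_def)

lemma underS_in_Field: "j \<in> underS r i \<Longrightarrow> j \<in> Field r"
  by (auto simp: underS_def intro: FieldI1)

lemma underS_Restr_underS:
  assumes "Well_order r" "k \<in> underS r i"
  shows "underS (Restr r (underS r i)) k = underS r k"
  using assms underS_mono[OF assms(1), of k i] by (auto simp: underS_def)

lemma Restr_Restr_underS: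
  assumes "Well_order r" "k \<in> underS r i"
  shows "Restr (Restr r (underS r i)) (underS r k) = Restr r (underS r k)"
  using underS_mono[OF assms(1), of k i] underS_memD[OF assms(2)] by blast

lemma limit_ordinal_Card_order:
  assumes "Card_order r" "infinite (Field r)"
  shows "limit_ordinal r"
  using assms infinite_Card_order_limit[OF assms] infinite_imp_nonempty[of "Field r"]
  by (auto simp: limit_ordinal_def card_order_on_def)

lemma Well_order_cases:
  assumes wo: "Well_order r" and i: "i \<in> Field r"
  obtains (least) "underS r i = {}"
    | (succ) j where "j \<in> underS r i" "underS r i = insert j (underS r j)"
    | (limit) "limit_ordinal (Restr r (underS r i))"
proof (cases "underS r i = {} \<or> limit_ordinal (Restr r (underS r i))")
  case False
  have "Well_order (Restr r (underS r i))" by (rule Well_order_Restr[OF wo])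
  then obtain j where j: "j \<in> underS r i"
    and top: "\<And>k. k \<in> underS r i \<Longrightarrow> (j, k) \<in> r \<Longrightarrow> k = j"
    using False Field_Restr_underS[OF wo] unfolding limit_ordinal_def by fastforce
  have "underS r i \<subseteq> insert j (underS r j)"
  proof
    fix k assume k: "k \<in> underS r i"
    then have "(j, k) \<in> r \<or> (k, j) \<in> r"
      using wo_rel.TOTALS[of r] wo underS_in_Field[OF j] underS_in_Field[OF k]
      unfolding wo_rel_def by blast
    then show "k \<in> insert j (underS r j)" using top[OF k] by (auto simp: underS_def)
  qed
  moreover have "underS r j \<subseteq> underS r i" using underS_mono[OF wo] underS_memD[OF j] by simp
  ultimately show ?thesis using j that(2)[OF j] by blast
qed (use that in blast)

text \<open>
  \<open>P\<close> is the invariant of the \<open>i\<close>-th member, \<open>T i\<close> the relation of the \<open>i\<close>-th member to all later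
  ones, and \<open>L i\<close> computes the member at a limit \<open>i\<close> from the preceding ones. Since \<open>T\<close> is transitive,
  a successor has to be compared with its predecessor only.
\<close>

lemma transfinite_chain:
  fixes r :: "'i rel" and P :: "'i \<Rightarrow> 'b \<Rightarrow> bool" and T :: "'i \<Rightarrow> 'b \<Rightarrow> 'b \<Rightarrow> bool"
    and L :: "'i \<Rightarrow> ('i \<Rightarrow> 'b) \<Rightarrow> 'b"
  assumes wo: "Well_order r"
    and trans: "\<And>i j k x y z. i \<in> underS r j \<Longrightarrow> j \<in> underS r k \<Longrightarrow> P i x \<Longrightarrow> P j y \<Longrightarrow> P k z \<Longrightarrow>
      T i x y \<Longrightarrow> T j y z \<Longrightarrow> T i x z"
    and least: "\<And>i. i \<in> Field r \<Longrightarrow> underS r i = {} \<Longrightarrow> \<exists>x. P i x"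
    and succ: "\<And>i j x. j \<in> underS r i \<Longrightarrow> underS r i = insert j (underS r j) \<Longrightarrow> P j x \<Longrightarrow>
      \<exists>y. P i y \<and> T j x y"
    and cong: "\<And>i (h :: 'i \<Rightarrow> 'b) h'. (\<And>j. j \<in> underS r i \<Longrightarrow> h j = h' j) \<Longrightarrow> L i h = L i h'"
    and limit: "\<And>i h. i \<in> Field r \<Longrightarrow> limit_ordinal (Restr r (underS r i)) \<Longrightarrow>
      (\<And>j. j \<in> underS r i \<Longrightarrow> P j (h j)) \<Longrightarrow>
      (\<And>j k. j \<in> underS r k \<Longrightarrow> k \<in> underS r i \<Longrightarrow> T j (h j) (h k)) \<Longrightarrow>
      (\<And>k. k \<in> underS r i \<Longrightarrow> limit_ordinal (Restr r (underS r k)) \<Longrightarrow> h k = L k h) \<Longrightarrow>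
      P i (L i h) \<and> (\<forall>j\<in>underS r i. T j (h j) (L i h))"
  shows "\<exists>h. (\<forall>i\<in>Field r. P i (h i)) \<and> (\<forall>i\<in>Field r. \<forall>j\<in>underS r i. T j (h j) (h i)) \<and>
    (\<forall>i\<in>Field r. limit_ordinal (Restr r (underS r i)) \<longrightarrow> h i = L i h)"
proof -
  define Q where "Q h i x \<longleftrightarrow> (i \<in> Field r \<longrightarrow> P i x \<and> (\<forall>j\<in>underS r i. T j (h j) x) \<and>
    (limit_ordinal (Restr r (underS r i)) \<longrightarrow> x = L i h))" for h i x
  have under: "(j, i) \<in> r - Id \<longleftrightarrow> j \<in> underS r i" for i j by (auto simp: underS_def)
  have "\<exists>h. \<forall>i. Q h i (h i)"
  proof (rule dependent_wf_choice)
    show "wf (r - Id)" using wo by (simp add: well_order_on_def)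
  next
    fix h h' :: "'i \<Rightarrow> 'b" and i x assume eq: "\<And>j. (j, i) \<in> r - Id \<Longrightarrow> h j = h' j"
    then have "L i h = L i h'" using cong[of i h h'] unfolding under by blast
    then show "Q h i x = Q h' i x" using eq unfolding Q_def under by auto
  next
    fix i h assume IH: "\<And>j. (j, i) \<in> r - Id \<Longrightarrow> Q h j (h j)"
    have P: "P j (h j)" and T: "\<And>k. k \<in> underS r j \<Longrightarrow> T k (h k) (h j)"
      and L: "limit_ordinal (Restr r (underS r j)) \<Longrightarrow> h j = L j h" if "j \<in> underS r i" for j
      using IH[of j] that underS_in_Field[OF that] unfolding under Q_def by blast+
    show "\<exists>x. Q h i x"
    proof (cases "i \<in> Field r")
      case i: True
      from wo i show ?thesis
      proof (cases rule: Well_order_cases)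
        case lst: least
        then have "\<not> limit_ordinal (Restr r (underS r i))"
          by (simp add: limit_ordinal_def)
        then show ?thesis using least[OF i lst] lst unfolding Q_def by auto
      next
        case scc: (succ j)
        obtain y where y: "P i y" "T j (h j) y" using succ[OF scc P[OF scc(1)]] by blast
        have "T k (h k) y" if "k \<in> underS r i" for k
        proof (cases "k = j")
          case False
          then have k: "k \<in> underS r j" using that scc by blast
          show ?thesis
            by (rule trans[OF k scc(1) P[OF that] P[OF scc(1)] y(1) T[OF scc(1) k] y(2)])
        qed (use y in simp)
        moreover have "\<not> limit_ordinal (Restr r (underS r i))"
        proof
          assume "limit_ordinal (Restr r (underS r i))"
          then obtain k where k: "k \<in> underS r i" "k \<noteq> j" "(j, k) \<in> r"
            using scc(1) Field_Restr_underS[OF wo, of i] unfolding limit_ordinal_def by auto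
          then have "k \<in> underS r j" using scc by blast
          then have "(k, j) \<in> r" by (simp add: underS_def)
          then show False
            using k wo_rel.ANTISYM[of r] wo unfolding wo_rel_def antisym_def by blast
        qed
        ultimately show ?thesis using y(1) unfolding Q_def by blast
      next
        case lim: limit
        have "P i (L i h) \<and> (\<forall>j\<in>underS r i. T j (h j) (L i h))"
          by (rule limit[OF i lim]) (use P T L in auto)
        then show ?thesis unfolding Q_def by blast
      qed
    qed (simp add: Q_def)
  qed
  then show ?thesis unfolding Q_def by blast
qed


section \<open>Embeddings and unions of chains in an abstract elementary class\<close>

context aec
begin

lemma leq_in_K: "M \<preceq> N \<Longrightarrow> M \<in> K" "M \<preceq> N \<Longrightarrow> N \<in> K"
  using partial_order_onD(4)[OF partial_order] by auto

lemma leq_refl: "M \<in> K \<Longrightarrow> M \<preceq> M"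
  using partial_order_onD(1)[OF partial_order] by (simp add: refl_on_def)

lemma leq_trans: "M \<preceq> N \<Longrightarrow> N \<preceq> R \<Longrightarrow> M \<preceq> R"
  using partial_order_onD(2)[OF partial_order] by (rule transD)

lemma leq_univ: "M \<preceq> N \<Longrightarrow> univ M \<subseteq> univ N"
  using leq_substruct by (simp add: substruct_def)

lemma leq_univ_eq: "M \<preceq> N \<Longrightarrow> univ M = univ N \<Longrightarrow> M = N"
  using substruct_eqI[OF structs structs leq_substruct] leq_in_K by blast

text \<open>
  Among \<open>\<preceq>\<close>-submodels of one model, \<open>\<preceq>\<close> is inclusion of universes. Submodels obtained from the
  Lowenheim-Skolem property are always compared in this way.
\<close>

lemma leq_coherence:
  assumes "M0 \<preceq> M2" "M1 \<preceq> M2" "univ M0 \<subseteq> univ M1"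
  shows "M0 \<preceq> M1"
proof (rule coherence[OF assms(1,2)])
  have t: "tuples (univ M0) n \<subseteq> tuples (univ M1) n" for n using assms(3) by (rule tuples_mono)
  have "fint M0 s xs = fint M1 s xs" if "s \<in> fsyms \<tau>" "xs \<in> tuples (univ M0) (far \<tau> s)" for s xs
    using leq_substruct[OF assms(1)] leq_substruct[OF assms(2)] that t[of "far \<tau> s"]
    by (auto simp: substruct_def)
  moreover have "rint M0 R = rint M1 R \<inter> tuples (univ M0) (rar \<tau> R)" if "R \<in> rsyms \<tau>" for R
    using leq_substruct[OF assms(1)] leq_substruct[OF assms(2)] that t[of "rar \<tau> R"]
    by (auto simp: substruct_def)
  ultimately show "substruct \<tau> M0 M1" using assms(3) by (auto simp: substruct_def)
qed

lemma img_in_K: "M \<in> K \<Longrightarrow> inj_on f (univ M) \<Longrightarrow> img \<tau> f M \<in> K"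
  using K_iso iso_img structs by blast

lemma img_leq: "M \<preceq> N \<Longrightarrow> inj_on f (univ N) \<Longrightarrow> img \<tau> f M \<preceq> img \<tau> f N"
  using leq_iso iso_img[OF structs[OF leq_in_K(2)]] by blast

lemma inj_on_leq: "M \<preceq> N \<Longrightarrow> inj_on f (univ N) \<Longrightarrow> inj_on f (univ M)"
  by (rule inj_on_subset[OF _ leq_univ])

text \<open>
  An isomorphism determines its target, so only the image of the map matters. The source is a model
  because it is the image of its image under the inverse map.
\<close>

lemma K_embedding_iff:
  "K_embedding f M N \<longleftrightarrow> M \<in> K \<and> inj_on f (univ M) \<and> img \<tau> f M \<preceq> N"
proof
  assume "K_embedding f M N"
  then obtain M' where iso: "iso \<tau> f M M'" and le: "M' \<preceq> N" by (auto simp: K_embedding_def)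
  have eq: "M' = img \<tau> f M" by (rule iso_imp_eq_img[OF iso])
  have M: "is_struct \<tau> M" and inj: "inj_on f (univ M)" using iso by (auto simp: iso_def bij_betw_def)
  let ?g = "inv_into (univ M) f"
  have g: "inj_on ?g (f ` univ M)" by (rule inj_on_inv_into) simp
  have "img \<tau> ?g M' = img \<tau> (?g \<circ> f) M" unfolding eq by (rule img_comp[OF M inj g])
  also have "\<dots> = M" using inj by (intro img_ident[OF M]) simp
  finally have "M \<in> K" using img_in_K[of M' ?g] leq_in_K(1)[OF le] g eq by simp
  then show "M \<in> K \<and> inj_on f (univ M) \<and> img \<tau> f M \<preceq> N" using inj le eq by simp
next
  assume "M \<in> K \<and> inj_on f (univ M) \<and> img \<tau> f M \<preceq> N"
  then show "K_embedding f M N"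
    using iso_img[OF structs, of M f] by (auto simp: K_embedding_def)
qed

lemma K_embedding_ident: "M \<preceq> N \<Longrightarrow> (\<And>x. x \<in> univ M \<Longrightarrow> f x = x) \<Longrightarrow> K_embedding f M N"
  using img_ident[OF structs, of M f] leq_in_K by (auto simp: K_embedding_iff inj_on_def)

lemma K_embedding_cong:
  assumes "K_embedding f M N" and eq: "\<And>x. x \<in> univ M \<Longrightarrow> f x = g x"
  shows "K_embedding g M N"
proof -
  have M: "M \<in> K" "inj_on f (univ M)" "img \<tau> f M \<preceq> N" using assms(1) by (auto simp: K_embedding_iff)
  have "img \<tau> f M = img \<tau> g M" by (rule img_cong[OF structs[OF M(1)] eq])
  moreover have "inj_on g (univ M)" using M(2) eq by (auto simp: inj_on_def)
  ultimately show ?thesis using M by (simp add: K_embedding_iff)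
qed

lemma K_embedding_subset: "K_embedding f M N \<Longrightarrow> f ` univ M \<subseteq> univ N"
  using leq_univ[of "img \<tau> f M" N] by (simp add: K_embedding_iff)

lemma K_embedding_restrict: "K_embedding f M N \<Longrightarrow> M' \<preceq> M \<Longrightarrow> K_embedding f M' N"
  unfolding K_embedding_iff by (meson img_leq inj_on_leq leq_in_K leq_trans)

lemma K_embedding_img: "M \<preceq> N \<Longrightarrow> inj_on f (univ N) \<Longrightarrow> K_embedding f M (img \<tau> f N)"
  unfolding K_embedding_iff by (meson img_leq inj_on_leq leq_in_K)

lemma K_embedding_comp:
  assumes f: "K_embedding f M N" and g: "K_embedding g N R"
  shows "K_embedding (g \<circ> f) M R"
proof -
  have M: "M \<in> K" "inj_on f (univ M)" "img \<tau> f M \<preceq> N" and N: "inj_on g (univ N)" "img \<tau> g N \<preceq> R"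
    using f g by (auto simp: K_embedding_iff)
  have g': "inj_on g (f ` univ M)" using inj_on_leq[OF M(3) N(1)] by simp
  have "img \<tau> g (img \<tau> f M) \<preceq> R" by (rule leq_trans[OF img_leq[OF M(3) N(1)] N(2)])
  then show ?thesis
    using M g' img_comp[OF structs[OF M(1)] M(2) g'] by (simp add: K_embedding_iff comp_inj_on)
qed

lemma infinite_universe: "infinite (UNIV :: 'u set)"
  using LS_exists infinite_cardinal_UNIV by (auto simp: LS_bound_def)

text \<open>Up to isomorphism, an embedding into a model is an extension of the embedded model.\<close>

lemma K_embedding_pull_back:
  assumes f: "K_embedding f M N"
  obtains g where "inj g" "M \<preceq> img \<tau> g N" "\<And>x. x \<in> univ M \<Longrightarrow> g (f x) = x"
proof -
  have M: "M \<in> K" "inj_on f (univ M)" "img \<tau> f M \<preceq> N" using f by (auto simp: K_embedding_iff)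
  obtain \<pi> where \<pi>: "bij \<pi>" "\<And>x. x \<in> univ M \<Longrightarrow> \<pi> x = f x"
    using permutation_extending[OF infinite_universe _ M(2)] structs[OF M(1)]
    by (auto simp: is_struct_def)
  have inv: "inv \<pi> (f x) = x" if "x \<in> univ M" for x
    using \<pi>(2)[OF that, symmetric] bij_is_inj[OF \<pi>(1)] by simp
  have inj: "inj (inv \<pi>)" using \<pi>(1) by (simp add: bij_imp_bij_inv bij_is_inj)
  have "img \<tau> (inv \<pi>) (img \<tau> f M) = img \<tau> (inv \<pi> \<circ> f) M"
    by (rule img_comp[OF structs[OF M(1)] M(2) inj_on_subset[OF inj]]) simp
  also have "\<dots> = M" by (rule img_ident[OF structs[OF M(1)]]) (simp add: inv)
  finally have "M \<preceq> img \<tau> (inv \<pi>) N" using img_leq[OF M(3), of "inv \<pi>"] inj inj_on_subset by fastforce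
  then show ?thesis using that inj inv by blast
qed

lemma K_embedding_push_forward:
  assumes M: "M \<preceq> N" and f: "inj_on f (univ M)"
  obtains g where "inj g" "\<And>x. x \<in> univ M \<Longrightarrow> g x = f x" "img \<tau> f M = img \<tau> g M" "img \<tau> f M \<preceq> img \<tau> g N"
proof -
  obtain g where g: "bij g" "\<And>x. x \<in> univ M \<Longrightarrow> g x = f x"
    using permutation_extending[OF infinite_universe _ f] structs[OF leq_in_K(1)[OF M]]
    by (auto simp: is_struct_def)
  have eq: "img \<tau> f M = img \<tau> g M" using g by (intro img_cong structs leq_in_K(1)[OF M]) simp
  have inj: "inj g" using g by (simp add: bij_is_inj)
  have "img \<tau> f M \<preceq> img \<tau> g N" unfolding eq
    by (rule img_leq[OF M inj_on_subset[OF inj]]) simp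
  then show ?thesis using that inj g eq by blast
qed


text \<open>
  Cardinals are well-ordered, so the least bound that \<open>LS\<close> chooses exists.
\<close>

lemma LS_bound_LS: "LS_bound LS"
proof -
  have "\<forall>\<kappa>\<in>Collect LS_bound. Well_order \<kappa>"
    by (auto simp: LS_bound_def infinite_cardinal_def card_order_on_def)
  then have "\<exists>\<kappa>\<in>Collect LS_bound. \<forall>\<kappa>'\<in>Collect LS_bound. \<kappa> \<le>o \<kappa>'"
    by (rule exists_minim_Well_order[rotated]) (use LS_exists in auto)
  then have "\<exists>\<kappa>. LS_bound \<kappa> \<and> (\<forall>\<kappa>'. LS_bound \<kappa>' \<longrightarrow> \<kappa> \<le>o \<kappa>')" by auto
  from someI_ex[OF this] show ?thesis unfolding LS_def by blast
qed

lemma Cinfinite_above_LS: "Card_order c \<Longrightarrow> LS \<le>o c \<Longrightarrow> Cinfinite c"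
  using LS_bound_LS cinfinite_mono[of LS c]
  by (auto simp: LS_bound_def infinite_cardinal_def cinfinite_def)

lemma Lowenheim_Skolem:
  assumes N: "N \<in> K" and A: "A \<subseteq> univ N" "|A| \<le>o c" and c: "Card_order c" "LS \<le>o c"
  obtains M where "M \<preceq> N" "A \<subseteq> univ M" "|univ M| \<le>o c"
proof -
  obtain M where M: "M \<preceq> N" "A \<subseteq> univ M" "|univ M| \<le>o |A| +c LS"
    using LS_bound_LS N A(1) unfolding LS_bound_def by blast
  have "|A| +c LS \<le>o c +c c" by (rule csum_mono[OF A(2) c(2)])
  also have "c +c c =o c"
    by (rule csum_absorb1[OF Cinfinite_above_LS[OF c] ordLeq_refl[OF c(1)]])
  finally have "|univ M| \<le>o c" using M(3) ordLeq_transitive by blast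
  then show ?thesis using that M by blast
qed

lemma card_img: "|univ (img \<tau> f M)| \<le>o |univ M|" for f :: "'u \<Rightarrow> 'u"
  by (simp add: card_of_image)

lemma finite_subset_of_chain:
  assumes lin: "\<And>i j. i \<in> I \<Longrightarrow> j \<in> I \<Longrightarrow> Ms i \<preceq> Ms j \<or> Ms j \<preceq> Ms i" and I: "I \<noteq> {}"
    and F: "finite F" "F \<subseteq> (\<Union>i\<in>I. univ (Ms i))"
  shows "\<exists>i\<in>I. F \<subseteq> univ (Ms i)"
  using F
proof (induction F)
  case (insert x F)
  then obtain i j where ij: "i \<in> I" "F \<subseteq> univ (Ms i)" "j \<in> I" "x \<in> univ (Ms j)" by auto
  show ?case
    using lin[OF ij(1,3)] leq_univ[of "Ms i" "Ms j"] leq_univ[of "Ms j" "Ms i"] ij by blast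
qed (use I in auto)

lemma union_struct_img:
  assumes U: "U \<in> K" "univ U = (\<Union>i\<in>I. univ (Ms i))" and g: "inj_on g (univ U)"
    and sub: "\<And>i. i \<in> I \<Longrightarrow> Ms i \<preceq> U" and I: "I \<noteq> {}"
    and lin: "\<And>i j. i \<in> I \<Longrightarrow> j \<in> I \<Longrightarrow> Ms i \<preceq> Ms j \<or> Ms j \<preceq> Ms i"
  shows "union_struct \<tau> I (\<lambda>i. img \<tau> g (Ms i)) = img \<tau> g U"
proof (rule union_struct_eqI)
  show "is_struct \<tau> (img \<tau> g U)" using structs img_in_K U(1) g by blast
  fix i assume i: "i \<in> I"
  have le: "img \<tau> g (Ms i) \<preceq> img \<tau> g U" by (rule img_leq[OF sub[OF i] g])
  show "is_struct \<tau> (img \<tau> g (Ms i))" by (rule structs[OF leq_in_K(1)[OF le]])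
  show "substruct \<tau> (img \<tau> g (Ms i)) (img \<tau> g U)" by (rule leq_substruct[OF le])
next
  fix F assume F: "finite F" "F \<subseteq> univ (img \<tau> g U)"
  then obtain F' where F': "finite F'" "F' \<subseteq> univ U" "F = g ` F'"
    using finite_subset_image[of F g "univ U"] by auto
  then obtain i where "i \<in> I" "F' \<subseteq> univ (Ms i)"
    using finite_subset_of_chain[of I Ms F', OF lin I] U(2) by auto
  then show "\<exists>i\<in>I. F \<subseteq> univ (img \<tau> g (Ms i))" using F'(3) by auto
qed

lemma chain_linear:
  assumes "Well_order r" "chain r Ms" "i \<in> Field r" "j \<in> Field r"
  shows "Ms i \<preceq> Ms j \<or> Ms j \<preceq> Ms i"
proof -
  have "(i, j) \<in> r \<or> (j, i) \<in> r"
    using wo_rel.TOTALS[of r] assms by (simp add: wo_rel_def)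
  then show ?thesis using assms(2) by (auto simp: chain_def)
qed

lemma limit_ordinal_Well_order: "limit_ordinal r \<Longrightarrow> Well_order r"
  by (simp add: limit_ordinal_def)

lemma limit_ordinal_nonempty: "limit_ordinal r \<Longrightarrow> Field r \<noteq> {}"
  by (simp add: limit_ordinal_def)

lemma chainI:
  assumes K: "\<And>i. i \<in> Field r \<Longrightarrow> Ms i \<in> K"
    and le: "\<And>i j. j \<in> Field r \<Longrightarrow> i \<in> underS r j \<Longrightarrow> Ms i \<preceq> Ms j"
    and lim: "\<And>i. i \<in> Field r \<Longrightarrow> limit_ordinal (Restr r (underS r i)) \<Longrightarrow>
      Ms i = union_struct \<tau> (underS r i) Ms"
  shows "chain r Ms"
  unfolding chain_def
proof (intro conjI ballI allI impI)
  fix i j assume ij: "(i, j) \<in> r"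
  then have "i \<in> Field r" "j \<in> Field r" by (auto intro: FieldI1 FieldI2)
  then show "Ms i \<preceq> Ms j"
    using ij le[of j i] leq_refl[OF K] by (cases "i = j") (auto simp: underS_def)
qed (use K lim in auto)

lemma chain_Restr_underS:
  assumes wo: "Well_order r" and Ms: "chain r Ms"
  shows "chain (Restr r (underS r i)) Ms"
proof (rule chainI)
  note F = Field_Restr_underS[OF wo, of i]
  fix j assume "j \<in> Field (Restr r (underS r i))"
  then have j: "j \<in> underS r i" unfolding F .
  show "Ms j \<in> K" using Ms underS_in_Field[OF j] by (simp add: chain_def)
  show "Ms k \<preceq> Ms j" if "k \<in> underS (Restr r (underS r i)) j" for k
    using that Ms by (auto simp: chain_def underS_def)
  show "Ms j = union_struct \<tau> (underS (Restr r (underS r i)) j) Ms"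
    if "limit_ordinal (Restr (Restr r (underS r i)) (underS (Restr r (underS r i)) j))"
    using that Ms underS_in_Field[OF j]
    unfolding underS_Restr_underS[OF wo j] Restr_Restr_underS[OF wo j] by (simp add: chain_def)
qed

text \<open>
  Coherent embeddings between the members of two chains are presented as one map \<open>g\<close>. That the images
  form a continuous chain is what makes the smoothness axiom \<open>union_least\<close> applicable to them.
\<close>

lemma glue_embeddings:
  fixes r :: "'u rel"
  assumes r: "limit_ordinal r" "r <o |UNIV :: 'u set|"
    and Ms: "chain r Ms" and Ns: "chain r Ns"
    and g: "\<And>i. i \<in> Field r \<Longrightarrow> K_embedding g (Ms i) (Ns i)"
  shows "chain r (\<lambda>i. img \<tau> g (Ms i))"
    and "union_struct \<tau> (Field r) (\<lambda>i. img \<tau> g (Ms i)) = img \<tau> g (union_struct \<tau> (Field r) Ms)"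
    and "K_embedding g (union_struct \<tau> (Field r) Ms) (union_struct \<tau> (Field r) Ns)"
proof -
  let ?U = "union_struct \<tau> (Field r) Ms"
  have wo: "Well_order r" by (rule limit_ordinal_Well_order[OF r(1)])
  have U: "?U \<in> K" by (rule union_in_K[OF r Ms])
  have le: "Ms i \<preceq> ?U" if "i \<in> Field r" for i by (rule union_upper[OF r Ms that])
  have lin: "Ms i \<preceq> Ms j \<or> Ms j \<preceq> Ms i" if "i \<in> Field r" "j \<in> Field r" for i j
    by (rule chain_linear[OF wo Ms that])
  have inj: "inj_on g (univ ?U)"
  proof (rule inj_onI)
    fix x y assume xy: "x \<in> univ ?U" "y \<in> univ ?U" "g x = g y"
    then obtain i where i: "i \<in> Field r" "{x, y} \<subseteq> univ (Ms i)"
      using finite_subset_of_chain[of "Field r" Ms "{x, y}", OF lin limit_ordinal_nonempty[OF r(1)]]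
      by auto
    then show "x = y" using g[OF i(1)] xy(3) by (auto simp: K_embedding_iff inj_on_def)
  qed
  show ch: "chain r (\<lambda>i. img \<tau> g (Ms i))"
  proof (rule chainI)
    fix i assume i: "i \<in> Field r"
    have inji: "inj_on g (univ (Ms i))" by (rule inj_on_leq[OF le[OF i] inj])
    show "img \<tau> g (Ms i) \<in> K" by (rule img_in_K[OF leq_in_K(1)[OF le[OF i]] inji])
    show "img \<tau> g (Ms j) \<preceq> img \<tau> g (Ms i)" if "j \<in> underS r i" for j
      using that Ms by (intro img_leq[OF _ inji]) (auto simp: chain_def underS_def)
    show "img \<tau> g (Ms i) = union_struct \<tau> (underS r i) (\<lambda>i. img \<tau> g (Ms i))"
      if lim: "limit_ordinal (Restr r (underS r i))"
    proof (rule union_struct_img[symmetric])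
      show "Ms i \<in> K" by (rule leq_in_K(1)[OF le[OF i]])
      show "univ (Ms i) = (\<Union>j\<in>underS r i. univ (Ms j))"
        using Ms i lim by (metis chain_def univ_union_struct)
      show "inj_on g (univ (Ms i))" by (rule inji)
      show "Ms j \<preceq> Ms i" if "j \<in> underS r i" for j
        using that Ms by (auto simp: chain_def underS_def)
      show "underS r i \<noteq> {}"
        using limit_ordinal_nonempty[OF lim] Field_Restr_underS[OF wo, of i] by simp
      show "Ms j \<preceq> Ms k \<or> Ms k \<preceq> Ms j" if "j \<in> underS r i" "k \<in> underS r i" for j k
        by (rule lin[OF underS_in_Field[OF that(1)] underS_in_Field[OF that(2)]])
    qed
  qed
  show eq: "union_struct \<tau> (Field r) (\<lambda>i. img \<tau> g (Ms i)) = img \<tau> g ?U"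
    by (rule union_struct_img[OF U _ inj le limit_ordinal_nonempty[OF r(1)] lin]) simp
  have "img \<tau> g ?U \<preceq> union_struct \<tau> (Field r) Ns"
    unfolding eq[symmetric]
  proof (rule union_least[OF r ch])
    show "union_struct \<tau> (Field r) Ns \<in> K" by (rule union_in_K[OF r Ns])
    fix i assume i: "i \<in> Field r"
    show "img \<tau> g (Ms i) \<preceq> union_struct \<tau> (Field r) Ns"
      using g[OF i] union_upper[OF r Ns i] leq_trans unfolding K_embedding_iff by blast
  qed
  then show "K_embedding g ?U (union_struct \<tau> (Field r) Ns)"
    using U inj by (simp add: K_embedding_iff)
qed

end


section \<open>Cardinalities of initial segments\<close>

text \<open>
  The size allowed for the \<open>i\<close>-th member of a chain that starts with a model of size \<open>|U|\<close>. It stays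
  below the cardinal \<open>r\<close> and survives unions at limit stages, also when \<open>r\<close> is singular, where a union
  of fewer than \<open>r\<close> sets of arbitrary sizes below \<open>r\<close> may be too large.
\<close>

abbreviation seg_card :: "'a set \<Rightarrow> 'b rel \<Rightarrow> 'b \<Rightarrow> ('a + 'b) rel" where
  "seg_card U r i \<equiv> |U <+> underS r i|"

lemma seg_card_less:
  "Card_order r \<Longrightarrow> infinite (Field r) \<Longrightarrow> |U| <o r \<Longrightarrow> i \<in> Field r \<Longrightarrow> seg_card U r i <o r"
  by (rule card_of_Plus_ordLess_infinite_Field) (auto intro: card_of_underS)

lemma seg_card_mono: "Well_order r \<Longrightarrow> j \<in> underS r i \<Longrightarrow> seg_card U r j \<le>o seg_card U r i"
  using underS_mono[of r j i] underS_memD[of j r i] by (intro card_of_mono1) auto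

lemma UN_ordLeq_seg_card:
  assumes wo: "Well_order r" and U: "infinite U"
    and A: "\<And>j. j \<in> underS r i \<Longrightarrow> |A j| \<le>o seg_card U r j"
  shows "|\<Union>j\<in>underS r i. A j| \<le>o seg_card U r i"
proof (rule card_of_UNION_ordLeq_infinite)
  show "infinite (U <+> underS r i)" using U by (simp add: finite_Plus_iff)
  show "|underS r i| \<le>o seg_card U r i" by (rule card_of_Plus2)
  show "\<forall>j\<in>underS r i. |A j| \<le>o seg_card U r i"
    using A seg_card_mono[OF wo] ordLeq_transitive by blast
qed

lemma UN_ordLeq_Card_order:
  assumes r: "Card_order r" "infinite (Field r)" and U: "|U| <o r"
    and A: "\<And>j. j \<in> Field r \<Longrightarrow> |A j| \<le>o seg_card U r j"
  shows "|\<Union>j\<in>Field r. A j| \<le>o r"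
proof (rule card_of_UNION_ordLeq_infinite_Field[OF r(2,1)])
  show "|Field r| \<le>o r" using card_of_Field_ordIso[OF r(1)] ordIso_imp_ordLeq by blast
  show "\<forall>j\<in>Field r. |A j| \<le>o r"
    using A seg_card_less[OF r U] ordLeq_ordLess_trans ordLess_imp_ordLeq by blast
qed

lemma insert_ordLeq:
  assumes "|A| \<le>o |C|" "infinite C"
  shows "|insert a A| \<le>o |C|"
proof -
  have "|{a} \<union> A| \<le>o |C|"
    by (rule card_of_Un_ordLeq_infinite_Field)
      (use assms card_of_singl_ordLeq[of C a] in \<open>auto simp: Field_card_of card_of_card_order_on\<close>)
  then show ?thesis by simp
qed

section \<open>Constructing chains of models\<close>

context aec
begin

lemma infinite_above_LS: "LS \<le>o |C| \<Longrightarrow> infinite C"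
  using Cinfinite_above_LS[of "|C|"] by (simp add: card_of_card_order_on cinfinite_def Field_card_of)

text \<open>
  The situation at a limit stage of a recursion, when only the segment below \<open>i\<close> has been constructed.
\<close>

lemma union_at_limit:
  fixes r :: "'u rel"
  assumes wo: "Well_order r" and small: "r <o |UNIV :: 'u set|"
    and lim: "limit_ordinal (Restr r (underS r i))"
    and K: "\<And>j. j \<in> underS r i \<Longrightarrow> Ms j \<in> K"
    and le: "\<And>j k. j \<in> underS r k \<Longrightarrow> k \<in> underS r i \<Longrightarrow> Ms j \<preceq> Ms k"
    and cont: "\<And>k. k \<in> underS r i \<Longrightarrow> limit_ordinal (Restr r (underS r k)) \<Longrightarrow>
      Ms k = union_struct \<tau> (underS r k) Ms"
  shows "Restr r (underS r i) <o r" "Restr r (underS r i) <o |UNIV :: 'u set|"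
    and "chain (Restr r (underS r i)) Ms"
    and "union_struct \<tau> (underS r i) Ms \<in> K"
    and "\<And>j. j \<in> underS r i \<Longrightarrow> Ms j \<preceq> union_struct \<tau> (underS r i) Ms"
proof -
  note F = Field_Restr_underS[OF wo, of i]
  have ne: "underS r i \<noteq> {}" using limit_ordinal_nonempty[OF lim] F by simp
  then have "Field r \<noteq> {}" using underS_in_Field by fastforce
  then show less: "Restr r (underS r i) <o r" by (rule underS_Restr_ordLess[OF wo])
  show small': "Restr r (underS r i) <o |UNIV :: 'u set|" by (rule ordLess_transitive[OF less small])
  show ch: "chain (Restr r (underS r i)) Ms"
  proof (rule chainI)
    fix j assume "j \<in> Field (Restr r (underS r i))"
    then have j: "j \<in> underS r i" unfolding F .
    show "Ms j \<in> K" by (rule K[OF j])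
    show "Ms k \<preceq> Ms j" if "k \<in> underS (Restr r (underS r i)) j" for k
      using that unfolding underS_Restr_underS[OF wo j] by (rule le[OF _ j])
    show "Ms j = union_struct \<tau> (underS (Restr r (underS r i)) j) Ms"
      if "limit_ordinal (Restr (Restr r (underS r i)) (underS (Restr r (underS r i)) j))"
      using that cont[OF j] unfolding underS_Restr_underS[OF wo j] Restr_Restr_underS[OF wo j]
      by blast
  qed
  show "union_struct \<tau> (underS r i) Ms \<in> K" using union_in_K[OF lim small' ch] unfolding F .
  show "Ms j \<preceq> union_struct \<tau> (underS r i) Ms" if "j \<in> underS r i" for j
    using union_upper[OF lim small' ch] that unfolding F .
qed

text \<open>
  A strictly increasing continuous chain of length \<open>\<kappa>\<close> has a union of size at least \<open>\<kappa>\<close>. With the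
  Lowenheim-Skolem property, proper extensions can be kept so small that it has size exactly \<open>\<kappa>\<close>.
\<close>

lemma exists_model_of_card:
  fixes \<kappa> :: "'u rel"
  assumes \<kappa>: "infinite_cardinal \<kappa>" and M0: "M0 \<in> K" "LS \<le>o |univ M0|" "|univ M0| <o \<kappa>"
    and ext: "\<And>M. M \<in> K \<Longrightarrow> |univ M0| \<le>o |univ M| \<Longrightarrow> |univ M| <o \<kappa> \<Longrightarrow> \<exists>N. M \<prec> N"
  shows "K_card \<kappa> \<noteq> {}"
proof -
  have card: "Card_order \<kappa>" "infinite (Field \<kappa>)" and small: "\<kappa> <o |UNIV :: 'u set|"
    using \<kappa> by (auto simp: infinite_cardinal_def)
  have lim: "limit_ordinal \<kappa>" by (rule limit_ordinal_Card_order[OF card])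
  have wo: "Well_order \<kappa>" by (rule limit_ordinal_Well_order[OF lim])
  let ?c = "\<lambda>i. seg_card (univ M0) \<kappa> i"
  let ?P = "\<lambda>i M. M0 \<preceq> M \<and> |univ M| \<le>o ?c i"
  have inf: "infinite (univ M0)" by (rule infinite_above_LS[OF M0(2)])
  have LSc: "LS \<le>o ?c i" for i by (rule ordLeq_transitive[OF M0(2) card_of_Plus1])
  have "\<exists>h. (\<forall>i\<in>Field \<kappa>. ?P i (h i)) \<and> (\<forall>i\<in>Field \<kappa>. \<forall>j\<in>underS \<kappa> i. h j \<prec> h i) \<and>
    (\<forall>i\<in>Field \<kappa>. limit_ordinal (Restr \<kappa> (underS \<kappa> i)) \<longrightarrow> h i = union_struct \<tau> (underS \<kappa> i) h)"
  proof (rule transfinite_chain[OF wo])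
    show "M \<prec> R" if "M \<prec> N" "N \<prec> R" for M N R
      using that leq_trans partial_order_onD(3)[OF partial_order] unfolding antisym_def by blast
  next
    fix i show "\<exists>M. ?P i M" using leq_refl[OF M0(1)] card_of_Plus1 by blast
  next
    fix i j M assume ij: "j \<in> underS \<kappa> i" and M: "?P j M"
    have "|univ M| <o \<kappa>"
      using M seg_card_less[OF card M0(3) underS_in_Field[OF ij]] ordLeq_ordLess_trans by blast
    moreover have "|univ M0| \<le>o |univ M|" using M leq_univ by (intro card_of_mono1) blast
    ultimately obtain N where N: "M \<prec> N" using ext[of M] M leq_in_K by blast
    obtain b where b: "b \<in> univ N" "b \<notin> univ M" using N leq_univ_eq[of M N] leq_univ[of M N] by blast
    have "|univ M| \<le>o ?c i" using M seg_card_mono[OF wo ij] ordLeq_transitive by blast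
    then have ins: "|insert b (univ M)| \<le>o ?c i"
      by (rule insert_ordLeq) (simp add: inf)
    have "N \<in> K" "insert b (univ M) \<subseteq> univ N" using N b leq_univ[of M N] leq_in_K by auto
    then obtain M' where M': "M' \<preceq> N" "insert b (univ M) \<subseteq> univ M'" "|univ M'| \<le>o ?c i"
      using Lowenheim_Skolem[OF _ _ ins card_of_Card_order LSc, of N] by blast
    have "M \<preceq> M'" using leq_coherence[of M N M'] N M' by auto
    then show "\<exists>M'. ?P i M' \<and> M \<prec> M'" using M M' b(2) leq_trans by blast
  next
    fix i and h h' :: "'u \<Rightarrow> ('f, 'r, 'u) struct"
    assume "\<And>j. j \<in> underS \<kappa> i \<Longrightarrow> h j = h' j"
    then show "union_struct \<tau> (underS \<kappa> i) h = union_struct \<tau> (underS \<kappa> i) h'"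
      by (rule union_struct_cong)
  next
    fix i h assume i: "limit_ordinal (Restr \<kappa> (underS \<kappa> i))"
      and P: "\<And>j. j \<in> underS \<kappa> i \<Longrightarrow> ?P j (h j)"
      and T: "\<And>j k. j \<in> underS \<kappa> k \<Longrightarrow> k \<in> underS \<kappa> i \<Longrightarrow> h j \<prec> h k"
      and L: "\<And>k. k \<in> underS \<kappa> i \<Longrightarrow> limit_ordinal (Restr \<kappa> (underS \<kappa> k)) \<Longrightarrow>
        h k = union_struct \<tau> (underS \<kappa> k) h"
    let ?U = "union_struct \<tau> (underS \<kappa> i) h"
    have le: "h j \<preceq> ?U" if "j \<in> underS \<kappa> i" for j
      by (rule union_at_limit(5)[OF wo small i _ _ L that])
        (use P leq_in_K T in blast)+
    have "|univ ?U| \<le>o ?c i"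
      unfolding univ_union_struct by (rule UN_ordLeq_seg_card[OF wo inf]) (use P in blast)
    moreover have "M0 \<preceq> ?U"
      using limit_ordinal_nonempty[OF i] Field_Restr_underS[OF wo, of i] P le leq_trans by blast
    moreover have "h j \<noteq> ?U" if j: "j \<in> underS \<kappa> i" for j
    proof
      assume eq: "h j = ?U"
      obtain k where k: "k \<in> underS \<kappa> i" "j \<in> underS \<kappa> k"
        using i j Field_Restr_underS[OF wo, of i] unfolding limit_ordinal_def underS_def by blast
      have "h j \<prec> h k" "h k \<preceq> h j" using T[OF k(2,1)] le[OF k(1)] eq by auto
      then show False using partial_order_onD(3)[OF partial_order] unfolding antisym_def by blast
    qed
    ultimately show "?P i ?U \<and> (\<forall>j\<in>underS \<kappa> i. h j \<prec> ?U)" using le by blast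
  qed
  then obtain h where P: "\<And>i. i \<in> Field \<kappa> \<Longrightarrow> ?P i (h i)"
    and T: "\<And>i j. i \<in> Field \<kappa> \<Longrightarrow> j \<in> underS \<kappa> i \<Longrightarrow> h j \<prec> h i"
    and L: "\<And>i. i \<in> Field \<kappa> \<Longrightarrow> limit_ordinal (Restr \<kappa> (underS \<kappa> i)) \<Longrightarrow>
      h i = union_struct \<tau> (underS \<kappa> i) h" by blast
  let ?U = "union_struct \<tau> (Field \<kappa>) h"
  have ch: "chain \<kappa> h" by (rule chainI[OF _ _ L]) (use P T leq_in_K in blast)+
  have U: "?U \<in> K" by (rule union_in_K[OF lim small ch])
  \<comment> \<open>Distinct indices \<open>i\<close> yield distinct elements \<open>x\<close> if \<open>x\<close> appears in the chain right after stage \<open>i\<close>.\<close>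
  have "\<forall>i\<in>Field \<kappa>. \<exists>x. x \<notin> univ (h i) \<and> (\<exists>j\<in>Field \<kappa>. i \<in> underS \<kappa> j \<and> x \<in> univ (h j) \<and>
    (\<forall>k\<in>Field \<kappa>. i \<in> underS \<kappa> k \<longrightarrow> x \<in> univ (h k)))"
  proof
    fix i assume i: "i \<in> Field \<kappa>"
    have "\<exists>j. j \<in> Field \<kappa> \<and> i \<in> underS \<kappa> j"
      using lim i unfolding limit_ordinal_def underS_def by blast
    then have ne: "{j. i \<in> underS \<kappa> j} \<noteq> {}" "{j. i \<in> underS \<kappa> j} \<subseteq> Field \<kappa>"
      by (auto simp: underS_def intro: FieldI2)
    have wor: "wo_rel \<kappa>" using wo by (simp add: wo_rel_def)
    define j where "j = wo_rel.minim \<kappa> {j. i \<in> underS \<kappa> j}"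
    have j: "i \<in> underS \<kappa> j" "j \<in> Field \<kappa>" and min: "\<And>k. i \<in> underS \<kappa> k \<Longrightarrow> (j, k) \<in> \<kappa>"
      using wo_rel.minim_in[OF wor ne(2,1)] wo_rel.minim_least[OF wor ne(2)] ne(2)
      unfolding j_def by auto
    have "h i \<prec> h j" by (rule T[OF j(2,1)])
    then obtain x where "x \<in> univ (h j)" "x \<notin> univ (h i)"
      using leq_univ_eq[of "h i" "h j"] leq_univ[of "h i" "h j"] by blast
    moreover have "univ (h j) \<subseteq> univ (h k)" if "i \<in> underS \<kappa> k" for k
      using ch min[OF that] leq_univ unfolding chain_def by blast
    ultimately show "\<exists>x. x \<notin> univ (h i) \<and> (\<exists>j\<in>Field \<kappa>. i \<in> underS \<kappa> j \<and> x \<in> univ (h j) \<and>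
      (\<forall>k\<in>Field \<kappa>. i \<in> underS \<kappa> k \<longrightarrow> x \<in> univ (h k)))" using j by blast
  qed
  then obtain e where e: "\<And>i. i \<in> Field \<kappa> \<Longrightarrow> e i \<notin> univ (h i)"
    "\<And>i. i \<in> Field \<kappa> \<Longrightarrow> e i \<in> univ ?U"
    "\<And>i k. k \<in> Field \<kappa> \<Longrightarrow> i \<in> underS \<kappa> k \<Longrightarrow> e i \<in> univ (h k)"
    unfolding univ_union_struct by (metis UN_I underS_in_Field)
  have "inj_on e (Field \<kappa>)"
  proof (rule inj_onI, rule ccontr)
    fix i j assume ij: "i \<in> Field \<kappa>" "j \<in> Field \<kappa>" "e i = e j" "i \<noteq> j"
    have "(i, j) \<in> \<kappa> \<or> (j, i) \<in> \<kappa>" using wo_rel.TOTALS[of \<kappa>] wo ij by (simp add: wo_rel_def)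
    then have "i \<in> underS \<kappa> j \<or> j \<in> underS \<kappa> i" using ij(4) by (auto simp: underS_def)
    then show False using e(1)[OF ij(1)] e(1)[OF ij(2)] e(3)[of j i] e(3)[of i j] ij by auto
  qed
  then have "|Field \<kappa>| \<le>o |univ ?U|"
    using e(2) by (intro card_of_ordLeq[THEN iffD1] exI[of _ e] conjI image_subsetI)
  then have "\<kappa> \<le>o |univ ?U|"
    using card_of_Field_ordIso[OF card(1)] ordIso_ordLeq_trans ordIso_symmetric by blast
  moreover have "|univ ?U| \<le>o \<kappa>"
    unfolding univ_union_struct by (rule UN_ordLeq_Card_order[OF card M0(3)]) (use P in blast)
  ultimately have "?U \<in> K_card \<kappa>" using U by (simp add: K_card_def ordIso_iff_ordLeq)
  then show ?thesis by blast
qed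


text \<open>
  Enumerate \<open>M\<close> along \<open>r\<close> and put the \<open>i\<close>-th element into all members after the \<open>i\<close>-th one.
\<close>

lemma resolution_into_chain:
  fixes r :: "'u rel"
  assumes r: "infinite_cardinal r" and M0: "M0 \<preceq> M" "LS \<le>o |univ M0|" "|univ M0| <o r"
    and M: "|univ M| \<le>o r"
  obtains Ms where "chain r Ms" "union_struct \<tau> (Field r) Ms = M"
    "\<And>i. i \<in> Field r \<Longrightarrow> Ms i \<preceq> M" "\<And>i. i \<in> Field r \<Longrightarrow> M0 \<preceq> Ms i"
    "\<And>i. i \<in> Field r \<Longrightarrow> |univ (Ms i)| \<le>o seg_card (univ M0) r i"
    "\<And>i. i \<in> Field r \<Longrightarrow> underS r i = {} \<Longrightarrow> Ms i = M0"
proof -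
  have card: "Card_order r" "infinite (Field r)" and small: "r <o |UNIV :: 'u set|"
    using r by (auto simp: infinite_cardinal_def)
  have lim: "limit_ordinal r" by (rule limit_ordinal_Card_order[OF card])
  have wo: "Well_order r" by (rule limit_ordinal_Well_order[OF lim])
  let ?c = "\<lambda>i. seg_card (univ M0) r i"
  have inf: "infinite (univ M0)" by (rule infinite_above_LS[OF M0(2)])
  have LSc: "LS \<le>o ?c i" for i by (rule ordLeq_transitive[OF M0(2) card_of_Plus1])
  have "univ M \<noteq> {}" using inf leq_univ[OF M0(1)] by auto
  moreover have "|univ M| \<le>o |Field r|"
    by (rule ordLeq_ordIso_trans[OF M ordIso_symmetric[OF card_of_Field_ordIso[OF card(1)]]])
  ultimately obtain e where e: "e ` Field r = univ M"
    using card_of_ordLeq2[of "univ M" "Field r"] by blast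
  let ?P = "\<lambda>i N. N \<preceq> M \<and> M0 \<preceq> N \<and> |univ N| \<le>o ?c i \<and> (underS r i = {} \<longrightarrow> N = M0)"
  let ?T = "\<lambda>i N N'. N \<preceq> N' \<and> e i \<in> univ N'"
  have "\<exists>h. (\<forall>i\<in>Field r. ?P i (h i)) \<and> (\<forall>i\<in>Field r. \<forall>j\<in>underS r i. ?T j (h j) (h i)) \<and>
    (\<forall>i\<in>Field r. limit_ordinal (Restr r (underS r i)) \<longrightarrow> h i = union_struct \<tau> (underS r i) h)"
  proof (rule transfinite_chain[OF wo])
    fix i j N N' N'' assume "?T i N N'" "?T j N' N''"
    then show "?T i N N''" using leq_trans leq_univ by blast
  next
    fix i show "\<exists>N. ?P i N" using M0(1) leq_refl[OF leq_in_K(1)[OF M0(1)]] card_of_Plus1 by blast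
  next
    fix i j N assume ij: "j \<in> underS r i" and N: "?P j N"
    have "|univ N| \<le>o ?c i" using N seg_card_mono[OF wo ij] ordLeq_transitive by blast
    then have ins: "|insert (e j) (univ N)| \<le>o ?c i"
      by (rule insert_ordLeq) (simp add: inf)
    have "M \<in> K" "insert (e j) (univ N) \<subseteq> univ M"
      using N e underS_in_Field[OF ij] leq_univ[of N M] leq_in_K by auto
    then obtain N' where N': "N' \<preceq> M" "insert (e j) (univ N) \<subseteq> univ N'" "|univ N'| \<le>o ?c i"
      using Lowenheim_Skolem[OF _ _ ins card_of_Card_order LSc, of M] by blast
    have "N \<preceq> N'" using leq_coherence[of N M N'] N N' by auto
    then show "\<exists>N'. ?P i N' \<and> ?T j N N'" using N N' ij leq_trans by blast
  next
    fix i and h h' :: "'u \<Rightarrow> ('f, 'r, 'u) struct"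
    assume "\<And>j. j \<in> underS r i \<Longrightarrow> h j = h' j"
    then show "union_struct \<tau> (underS r i) h = union_struct \<tau> (underS r i) h'"
      by (rule union_struct_cong)
  next
    fix i h assume i: "limit_ordinal (Restr r (underS r i))"
      and P: "\<And>j. j \<in> underS r i \<Longrightarrow> ?P j (h j)"
      and T: "\<And>j k. j \<in> underS r k \<Longrightarrow> k \<in> underS r i \<Longrightarrow> ?T j (h j) (h k)"
      and L: "\<And>k. k \<in> underS r i \<Longrightarrow> limit_ordinal (Restr r (underS r k)) \<Longrightarrow>
        h k = union_struct \<tau> (underS r k) h"
    let ?U = "union_struct \<tau> (underS r i) h"
    note F = Field_Restr_underS[OF wo, of i]
    have hK: "h j \<in> K" if "j \<in> underS r i" for j using P[OF that] leq_in_K by blast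
    have hle: "h j \<preceq> h k" if "j \<in> underS r k" "k \<in> underS r i" for j k using T[OF that] by blast
    note U = union_at_limit[OF wo small i hK hle L]
    have "?U \<preceq> M"
      using union_least[OF i U(2,3), of M] P leq_in_K(2)[OF M0(1)] unfolding F by blast
    moreover have "|univ ?U| \<le>o ?c i"
      unfolding univ_union_struct by (rule UN_ordLeq_seg_card[OF wo inf]) (use P in blast)
    moreover have ne: "underS r i \<noteq> {}" using limit_ordinal_nonempty[OF i] F by simp
    moreover have "M0 \<preceq> ?U" using ne P U(5) leq_trans by blast
    moreover have "e j \<in> univ ?U" if j: "j \<in> underS r i" for j
    proof -
      obtain k where k: "k \<in> underS r i" "j \<in> underS r k"
        using i j F unfolding limit_ordinal_def underS_def by blast
      then show ?thesis using T[OF k(2,1)] by auto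
    qed
    ultimately show "?P i ?U \<and> (\<forall>j\<in>underS r i. ?T j (h j) ?U)" using U(5) by blast
  qed
  then obtain h where P: "\<And>i. i \<in> Field r \<Longrightarrow> ?P i (h i)"
    and T: "\<And>i j. i \<in> Field r \<Longrightarrow> j \<in> underS r i \<Longrightarrow> ?T j (h j) (h i)"
    and L: "\<And>i. i \<in> Field r \<Longrightarrow> limit_ordinal (Restr r (underS r i)) \<Longrightarrow>
      h i = union_struct \<tau> (underS r i) h" by blast
  have ch: "chain r h" by (rule chainI[OF _ _ L]) (use P T leq_in_K in blast)+
  have "univ M \<subseteq> univ (union_struct \<tau> (Field r) h)"
  proof
    fix x assume "x \<in> univ M"
    then obtain i where i: "i \<in> Field r" "x = e i" using e by blast
    then obtain j where "j \<in> Field r" "i \<in> underS r j"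
      using lim unfolding limit_ordinal_def underS_def by blast
    then show "x \<in> univ (union_struct \<tau> (Field r) h)" using T i(2) by auto
  qed
  moreover have le: "union_struct \<tau> (Field r) h \<preceq> M"
    by (rule union_least[OF lim small ch leq_in_K(2)[OF M0(1)]]) (use P in blast)
  ultimately have "union_struct \<tau> (Field r) h = M"
    using leq_univ[OF le] by (intro leq_univ_eq[OF le]) blast
  then show ?thesis using that[OF ch] P by blast
qed

text \<open>
  The union of the functions \<open>fs i\<close> on the universes of the models \<open>Ms i\<close>, provided that they agree
  where they overlap. The fixed default outside makes it depend only on the \<open>fs i\<close> with \<open>i \<in> I\<close>, as the
  recursion requires.
\<close>

definition glue :: "('i \<Rightarrow> ('f, 'r, 'u) struct) \<Rightarrow> 'i set \<Rightarrow> ('i \<Rightarrow> 'u \<Rightarrow> 'u) \<Rightarrow> 'u \<Rightarrow> 'u" where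
  "glue Ms I fs x =
     (if \<exists>i. i \<in> I \<and> x \<in> univ (Ms i) then fs (SOME i. i \<in> I \<and> x \<in> univ (Ms i)) x else x)"

lemma glue_cong:
  assumes eq: "\<And>i. i \<in> I \<Longrightarrow> fs i = gs i"
  shows "glue Ms I fs = glue Ms I gs"
proof
  fix x show "glue Ms I fs x = glue Ms I gs x"
  proof (cases "\<exists>i. i \<in> I \<and> x \<in> univ (Ms i)")
    case True
    from someI_ex[OF this] have "fs (SOME i. i \<in> I \<and> x \<in> univ (Ms i)) = gs (SOME i. i \<in> I \<and> x \<in> univ (Ms i))"
      using eq by blast
    then show ?thesis by (simp only: glue_def)
  qed (simp only: glue_def if_False)
qed

lemma glue_eq:
  assumes coh: "\<And>j k. j \<in> I \<Longrightarrow> k \<in> I \<Longrightarrow> x \<in> univ (Ms j) \<Longrightarrow> x \<in> univ (Ms k) \<Longrightarrow> fs j x = fs k x"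
    and i: "i \<in> I" "x \<in> univ (Ms i)"
  shows "glue Ms I fs x = fs i x"
proof -
  have ex: "\<exists>i. i \<in> I \<and> x \<in> univ (Ms i)" using i by blast
  from someI_ex[OF this] have "fs (SOME i. i \<in> I \<and> x \<in> univ (Ms i)) x = fs i x"
    using coh[OF _ i(1) _ i(2)] by blast
  then show ?thesis unfolding glue_def if_P[OF ex] .
qed

text \<open>
  One-step amalgamation, iterated along a chain. The relation \<open>P\<close> between the image of a member and
  the model into which it is embedded is carried along; it is what will keep a given element of
  \<open>N0\<close> outside the image of the whole chain.
\<close>

lemma amalgamation_along_chain:
  fixes r :: "'u rel" and P :: "('f, 'r, 'u) struct \<Rightarrow> ('f, 'r, 'u) struct \<Rightarrow> bool"
  assumes r: "infinite_cardinal r" and Ms: "chain r Ms"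
    and start: "\<And>i. i \<in> Field r \<Longrightarrow> underS r i = {} \<Longrightarrow> Ms i = M0"
    and M0_le: "\<And>i. i \<in> Field r \<Longrightarrow> M0 \<preceq> Ms i"
    and N0: "M0 \<preceq> N0" "LS \<le>o |univ N0|" "|univ N0| <o r" "P M0 N0"
    and size: "\<And>i. i \<in> Field r \<Longrightarrow> |univ (Ms i)| \<le>o seg_card (univ N0) r i"
    and up: "\<And>A N N'. P A N \<Longrightarrow> A \<preceq> N \<Longrightarrow> N \<preceq> N' \<Longrightarrow> P A N'"
    and step: "\<And>A B N (C :: ('u + 'u) set). A \<preceq> N \<Longrightarrow> A \<preceq> B \<Longrightarrow> P A N \<Longrightarrow> LS \<le>o |C| \<Longrightarrow> |C| <o r \<Longrightarrow>
      |univ B| \<le>o |C| \<Longrightarrow> |univ N| \<le>o |C| \<Longrightarrow>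
      \<exists>N' g. N \<preceq> N' \<and> |univ N'| \<le>o |C| \<and> K_embedding g B N' \<and> (\<forall>x\<in>univ A. g x = x) \<and>
        P (img \<tau> g B) N'"
    and limit: "\<And>s As N. limit_ordinal (s :: 'u rel) \<Longrightarrow> s <o r \<Longrightarrow> chain s As \<Longrightarrow>
      (\<And>i. i \<in> Field s \<Longrightarrow> As i \<preceq> N \<and> P (As i) N) \<Longrightarrow> union_struct \<tau> (Field s) As \<preceq> N \<Longrightarrow>
      |univ (union_struct \<tau> (Field s) As)| <o r \<Longrightarrow> P (union_struct \<tau> (Field s) As) N"
  obtains N f where "N0 \<preceq> N" "K_embedding f (union_struct \<tau> (Field r) Ms) N"
    "\<And>x. x \<in> univ M0 \<Longrightarrow> f x = x" "\<And>i. i \<in> Field r \<Longrightarrow> P (img \<tau> f (Ms i)) N"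
proof -
  have card: "Card_order r" "infinite (Field r)" and small: "r <o |UNIV :: 'u set|"
    using r by (auto simp: infinite_cardinal_def)
  have lim: "limit_ordinal r" by (rule limit_ordinal_Card_order[OF card])
  have wo: "Well_order r" by (rule limit_ordinal_Well_order[OF lim])
  let ?c = "\<lambda>i. seg_card (univ N0) r i"
  have inf: "infinite (univ N0)" by (rule infinite_above_LS[OF N0(2)])
  have LSc: "LS \<le>o ?c i" for i by (rule ordLeq_transitive[OF N0(2) card_of_Plus1])
  have Ms_le: "Ms j \<preceq> Ms i" if "j \<in> underS r i" for i j
    using Ms that by (simp add: chain_def underS_def)
  let ?P = "\<lambda>i (N, f). N0 \<preceq> N \<and> |univ N| \<le>o ?c i \<and> K_embedding f (Ms i) N \<and>
    P (img \<tau> f (Ms i)) N \<and> (\<forall>x\<in>univ M0. f x = x)"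
  let ?T = "\<lambda>i (N, f) (N', f'). N \<preceq> N' \<and> (\<forall>x\<in>univ (Ms i). f x = f' x)"
  let ?N = "\<lambda>I h. union_struct \<tau> I (\<lambda>i. fst (h i))"
  let ?f = "\<lambda>I h. glue Ms I (\<lambda>i. snd (h i))"
  \<comment> \<open>Used for the segments \<open>I\<close> below limits, and at the end for \<open>I = Field r\<close>.\<close>
  have coherent: "?f I h x = snd (h i) x"
    if T: "\<And>j k. j \<in> I \<Longrightarrow> k \<in> I \<Longrightarrow> j \<in> underS r k \<Longrightarrow> ?T j (h j) (h k)" and I: "I \<subseteq> Field r"
      and i: "i \<in> I" "x \<in> univ (Ms i)" for I h i x
  proof -
    have "snd (h j) x = snd (h k) x"
      if jk: "j \<in> I" "k \<in> I" "x \<in> univ (Ms j)" "x \<in> univ (Ms k)" for j k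
    proof -
      have "(j, k) \<in> r \<or> (k, j) \<in> r"
        using wo_rel.TOTALS[of r] wo jk I unfolding wo_rel_def by blast
      then have "j = k \<or> j \<in> underS r k \<or> k \<in> underS r j" by (auto simp: underS_def)
      then show ?thesis using T[of j k] T[of k j] jk by (auto simp: case_prod_beta)
    qed
    from glue_eq[of I x Ms "\<lambda>i. snd (h i)", OF this i] show ?thesis .
  qed
  have "\<exists>h. (\<forall>i\<in>Field r. ?P i (h i)) \<and> (\<forall>i\<in>Field r. \<forall>j\<in>underS r i. ?T j (h j) (h i)) \<and>
    (\<forall>i\<in>Field r. limit_ordinal (Restr r (underS r i)) \<longrightarrow>
      h i = (?N (underS r i) h, ?f (underS r i) h))"
  proof (rule transfinite_chain[OF wo])
    fix i j k x y z assume "i \<in> underS r j" "?T i x y" "?T j y z"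
    then show "?T i x z"
      using leq_univ[OF Ms_le[of i j]] leq_trans by (fastforce simp: case_prod_beta)
  next
    fix i assume i: "i \<in> Field r" "underS r i = {}"
    have "K_embedding id (Ms i) N0" "img \<tau> id (Ms i) = M0"
      using start[OF i] N0(1) img_ident[OF structs[OF leq_in_K(1)[OF N0(1)]]]
      by (auto intro: K_embedding_ident)
    then have "?P i (N0, id)"
      using N0 leq_refl[OF leq_in_K(2)[OF N0(1)]] card_of_Plus1 by auto
    then show "\<exists>x. ?P i x" by blast
  next
    fix i j x assume ij: "j \<in> underS r i" and Px: "?P j x"
    obtain N f where x: "x = (N, f)" by fastforce
    have N: "N0 \<preceq> N" "|univ N| \<le>o ?c j" "K_embedding f (Ms j) N" "P (img \<tau> f (Ms j)) N"
      "\<And>x. x \<in> univ M0 \<Longrightarrow> f x = x" using Px unfolding x by auto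
    have i: "i \<in> Field r" using ij by (auto simp: underS_def intro: FieldI2)
    have f: "inj_on f (univ (Ms j))" "img \<tau> f (Ms j) \<preceq> N" using N(3) by (auto simp: K_embedding_iff)
    \<comment> \<open>Amalgamation needs an actual extension of \<open>f[Ms j]\<close>, so \<open>Ms i\<close> is first replaced by a copy of it.\<close>
    obtain \<pi> where \<pi>: "inj \<pi>" "\<And>x. x \<in> univ (Ms j) \<Longrightarrow> \<pi> x = f x"
      "img \<tau> f (Ms j) = img \<tau> \<pi> (Ms j)" "img \<tau> f (Ms j) \<preceq> img \<tau> \<pi> (Ms i)"
      by (rule K_embedding_push_forward[OF Ms_le[OF ij] f(1)]) blast
    have inj: "inj_on \<pi> (univ (Ms i))" using \<pi>(1) by (rule inj_on_subset) simp
    have "|univ N| \<le>o ?c i" by (rule ordLeq_transitive[OF N(2) seg_card_mono[OF wo ij]])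
    moreover have "|univ (img \<tau> \<pi> (Ms i))| \<le>o ?c i" by (rule ordLeq_transitive[OF card_img size[OF i]])
    ultimately obtain N' g where N': "N \<preceq> N'" "|univ N'| \<le>o ?c i"
      "K_embedding g (img \<tau> \<pi> (Ms i)) N'" "\<And>x. x \<in> univ (img \<tau> f (Ms j)) \<Longrightarrow> g x = x"
      "P (img \<tau> g (img \<tau> \<pi> (Ms i))) N'"
      using step[OF f(2) \<pi>(4) N(4) LSc seg_card_less[OF card N0(3) i]] by blast
    have MsK: "Ms i \<in> K" using Ms i by (simp add: chain_def)
    have emb: "K_embedding (g \<circ> \<pi>) (Ms i) N'"
      by (rule K_embedding_comp[OF K_embedding_img[OF leq_refl[OF MsK] inj] N'(3)])
    have "img \<tau> g (img \<tau> \<pi> (Ms i)) = img \<tau> (g \<circ> \<pi>) (Ms i)"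
      using N'(3) by (intro img_comp[OF structs[OF MsK] inj]) (simp add: K_embedding_iff)
    with N'(5) have P': "P (img \<tau> (g \<circ> \<pi>) (Ms i)) N'" by simp
    have eq: "f x = (g \<circ> \<pi>) x" if "x \<in> univ (Ms j)" for x
      using that N'(4)[of "f x"] \<pi>(2)[OF that] by simp
    have ident: "(g \<circ> \<pi>) x = x" if "x \<in> univ M0" for x
      using eq[of x] N(5)[OF that] that leq_univ[OF M0_le[OF underS_in_Field[OF ij]]] by auto
    have "?P i (N', g \<circ> \<pi>) \<and> ?T j x (N', g \<circ> \<pi>)"
      unfolding x prod.case
      by (intro conjI ballI leq_trans[OF N(1) N'(1)] N'(1,2) emb P' ident eq)
    then show "\<exists>y. ?P i y \<and> ?T j x y" by blast
  next
    fix i and h h' :: "'u \<Rightarrow> ('f, 'r, 'u) struct \<times> ('u \<Rightarrow> 'u)"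
    assume eq: "\<And>j. j \<in> underS r i \<Longrightarrow> h j = h' j"
    have "?N (underS r i) h = ?N (underS r i) h'" by (rule union_struct_cong) (simp add: eq)
    moreover have "?f (underS r i) h = ?f (underS r i) h'" by (rule glue_cong) (simp add: eq)
    ultimately show "(?N (underS r i) h, ?f (underS r i) h) = (?N (underS r i) h', ?f (underS r i) h')"
      by blast
  next
    fix i h assume iF: "i \<in> Field r" and i: "limit_ordinal (Restr r (underS r i))"
      and P: "\<And>j. j \<in> underS r i \<Longrightarrow> ?P j (h j)"
      and T: "\<And>j k. j \<in> underS r k \<Longrightarrow> k \<in> underS r i \<Longrightarrow> ?T j (h j) (h k)"
      and L: "\<And>k. k \<in> underS r i \<Longrightarrow> limit_ordinal (Restr r (underS r k)) \<Longrightarrow>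
        h k = (?N (underS r k) h, ?f (underS r k) h)"
    note F = Field_Restr_underS[OF wo, of i]
    let ?I = "underS r i"
    let ?g = "?f ?I h" and ?U = "?N ?I h"
    have IF: "?I \<subseteq> Field r" using underS_in_Field by fastforce
    have ne: "?I \<noteq> {}" using limit_ordinal_nonempty[OF i] F by simp
    have P': "N0 \<preceq> fst (h j)" "|univ (fst (h j))| \<le>o ?c j" "K_embedding (snd (h j)) (Ms j) (fst (h j))"
      "P (img \<tau> (snd (h j)) (Ms j)) (fst (h j))" "\<forall>x\<in>univ M0. snd (h j) x = x" if "j \<in> ?I" for j
      using P[OF that] by (simp_all add: case_prod_beta)
    have NK: "fst (h j) \<in> K" if "j \<in> ?I" for j by (rule leq_in_K(2)[OF P'(1)[OF that]])
    have Nle: "fst (h j) \<preceq> fst (h k)" if "j \<in> underS r k" "k \<in> ?I" for j k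
      using T[OF that] by (simp add: case_prod_beta)
    have NL: "fst (h k) = union_struct \<tau> (underS r k) (\<lambda>j. fst (h j))"
      if "k \<in> ?I" "limit_ordinal (Restr r (underS r k))" for k
      by (rule arg_cong[OF L[OF that], of fst, unfolded fst_conv])
    have less: "Restr r ?I <o r" "Restr r ?I <o |UNIV :: 'u set|"
      using underS_Restr_ordLess[OF wo] iF small ordLess_transitive by blast+
    have chN: "chain (Restr r ?I) (\<lambda>j. fst (h j))"
      by (rule union_at_limit(3)[OF wo small i NK Nle NL])
    have le_U: "fst (h j) \<preceq> ?U" if "j \<in> ?I" for j
      by (rule union_at_limit(5)[OF wo small i NK Nle NL that])
    have g: "?g x = snd (h j) x" if "j \<in> ?I" "x \<in> univ (Ms j)" for j x
      by (rule coherent[OF _ IF that]) (rule T)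
    have emb: "K_embedding ?g (Ms j) (fst (h j))" if "j \<in> ?I" for j
      by (rule K_embedding_cong[OF P'(3)[OF that] g[OF that, symmetric]])
    have Ms_lim: "union_struct \<tau> ?I Ms = Ms i" using Ms iF i by (simp add: chain_def)
    have MsK: "Ms j \<in> K" if "j \<in> ?I" for j using Ms underS_in_Field[OF that] by (simp add: chain_def)
    have emb': "K_embedding ?g (Ms j) (fst (h j))" if "j \<in> Field (Restr r ?I)" for j
      using emb that unfolding F .
    note G = glue_embeddings[OF i less(2) chain_Restr_underS[OF wo Ms] chN emb', unfolded F Ms_lim]
    have G1: "chain (Restr r ?I) (\<lambda>j. img \<tau> ?g (Ms j))" by (rule G(1))
    have G2: "union_struct \<tau> ?I (\<lambda>j. img \<tau> ?g (Ms j)) = img \<tau> ?g (Ms i)" by (rule G(2))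
    have G3: "K_embedding ?g (Ms i) ?U" by (rule G(3))
    have size: "|univ ?U| \<le>o ?c i"
      unfolding univ_union_struct
      by (rule UN_ordLeq_seg_card[OF wo inf P'(2)])
    have le: "img \<tau> ?g (Ms i) \<preceq> ?U" using G3 by (simp add: K_embedding_iff)
    have "P (union_struct \<tau> (Field (Restr r ?I)) (\<lambda>j. img \<tau> ?g (Ms j))) ?U"
    proof (rule limit[OF i less(1) G1], unfold F G2)
      fix j assume j: "j \<in> ?I"
      have "img \<tau> ?g (Ms j) = img \<tau> (snd (h j)) (Ms j)"
        by (rule img_cong[OF structs[OF MsK[OF j]] g[OF j]])
      then have "P (img \<tau> ?g (Ms j)) (fst (h j))" using P'(4)[OF j] by simp
      moreover have "img \<tau> ?g (Ms j) \<preceq> fst (h j)" using emb[OF j] by (simp add: K_embedding_iff)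
      ultimately show "img \<tau> ?g (Ms j) \<preceq> ?U \<and> P (img \<tau> ?g (Ms j)) ?U"
        using up le_U[OF j] leq_trans by blast
    next
      show "img \<tau> ?g (Ms i) \<preceq> ?U" by (rule le)
      have "|univ (img \<tau> ?g (Ms i))| \<le>o |univ ?U|" using leq_univ[OF le] by (rule card_of_mono1)
      then show "|univ (img \<tau> ?g (Ms i))| <o r"
        by (rule ordLeq_ordLess_trans[OF _ ordLeq_ordLess_trans[OF size seg_card_less[OF card N0(3) iF]]])
    qed
    then have PU: "P (img \<tau> ?g (Ms i)) ?U" unfolding F G2 .
    obtain j where j: "j \<in> ?I" using ne by blast
    have ident: "?g x = x" if "x \<in> univ M0" for x
      using g[OF j, of x] that leq_univ[OF M0_le[OF underS_in_Field[OF j]]] P'(5)[OF j] by auto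
    have T': "?T j (h j) (?U, ?g)" if "j \<in> ?I" for j
      using le_U[OF that] g[OF that] by (simp add: case_prod_beta)
    have "?P i (?U, ?g)"
      unfolding prod.case
      by (intro conjI ballI leq_trans[OF P'(1)[OF j] le_U[OF j]] size G3 PU ident)
    then show "?P i (?U, ?g) \<and> (\<forall>j\<in>?I. ?T j (h j) (?U, ?g))"
      by (rule conjI[OF _ ballI[OF T']])
  qed
  then obtain h where h: "\<forall>i\<in>Field r. ?P i (h i)"
      "\<forall>i\<in>Field r. \<forall>j\<in>underS r i. ?T j (h j) (h i)"
      "\<forall>i\<in>Field r. limit_ordinal (Restr r (underS r i)) \<longrightarrow>
        h i = (?N (underS r i) h, ?f (underS r i) h)"
    by (elim exE conjE) (rule that)
  have P: "?P i (h i)" if "i \<in> Field r" for i by (rule bspec[OF h(1) that])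
  have T: "?T j (h j) (h i)" if "i \<in> Field r" "j \<in> underS r i" for i j
    by (rule bspec[OF bspec[OF h(2) that(1)] that(2)])
  have L: "h i = (?N (underS r i) h, ?f (underS r i) h)"
    if "i \<in> Field r" "limit_ordinal (Restr r (underS r i))" for i
    by (rule mp[OF bspec[OF h(3) that(1)] that(2)])
  let ?g = "?f (Field r) h" and ?U = "?N (Field r) h"
  have P': "N0 \<preceq> fst (h j)" "K_embedding (snd (h j)) (Ms j) (fst (h j))"
    "P (img \<tau> (snd (h j)) (Ms j)) (fst (h j))" "\<forall>x\<in>univ M0. snd (h j) x = x" if "j \<in> Field r" for j
    using P[OF that] by (simp_all add: case_prod_beta)
  have ch: "chain r (\<lambda>i. fst (h i))"
  proof (rule chainI)
    fix i assume i: "i \<in> Field r"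
    show "fst (h i) \<in> K" by (rule leq_in_K(2)[OF P'(1)[OF i]])
    show "fst (h j) \<preceq> fst (h i)" if "j \<in> underS r i" for j
      using T[OF i that] by (simp add: case_prod_beta)
    show "fst (h i) = union_struct \<tau> (underS r i) (\<lambda>j. fst (h j))"
      if "limit_ordinal (Restr r (underS r i))"
      by (rule arg_cong[OF L[OF i that], of fst, unfolded fst_conv])
  qed
  have g: "?g x = snd (h j) x" if "j \<in> Field r" "x \<in> univ (Ms j)" for j x
    by (rule coherent[OF _ subset_refl that]) (rule T)
  have emb: "K_embedding ?g (Ms j) (fst (h j))" if "j \<in> Field r" for j
    by (rule K_embedding_cong[OF P'(2)[OF that] g[OF that, symmetric]])
  have up_U: "fst (h j) \<preceq> ?U" if "j \<in> Field r" for j by (rule union_upper[OF lim small ch that])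
  obtain i where i: "i \<in> Field r" using limit_ordinal_nonempty[OF lim] by blast
  show ?thesis
  proof (rule that)
    show "N0 \<preceq> ?U" by (rule leq_trans[OF P'(1)[OF i] up_U[OF i]])
    show "K_embedding ?g (union_struct \<tau> (Field r) Ms) ?U"
      by (rule glue_embeddings(3)[OF lim small Ms ch emb])
    show "?g x = x" if "x \<in> univ M0" for x
      using g[OF i, of x] that leq_univ[OF M0_le[OF i]] P'(4)[OF i] by auto
    fix j assume j: "j \<in> Field r"
    have MsK: "Ms j \<in> K" using Ms j by (simp add: chain_def)
    have "img \<tau> ?g (Ms j) = img \<tau> (snd (h j)) (Ms j)"
      by (rule img_cong[OF structs[OF MsK] g[OF j]])
    then have "P (img \<tau> ?g (Ms j)) (fst (h j))" using P'(3)[OF j] by simp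
    moreover have "img \<tau> ?g (Ms j) \<preceq> fst (h j)" using emb[OF j] by (simp add: K_embedding_iff)
    ultimately show "P (img \<tau> ?g (Ms j)) ?U" using up up_U[OF j] by blast
  qed
qed

end


section \<open>Galois types\<close>

context aec
begin

lemma E_atD:
  assumes "((a, M, N), (b, M', R)) \<in> E_at"
  shows "M' = M" "M \<preceq> N" "M \<preceq> R" "a \<in> univ N" "b \<in> univ R"
    and "\<exists>L\<in>K. \<exists>f g. K_embedding_over (univ M) f N L \<and> K_embedding_over (univ M) g R L \<and> f a = g b"
  using assms unfolding E_at_def by auto

lemma E_atI:
  assumes "M \<preceq> N" "M \<preceq> R" "a \<in> univ N" "b \<in> univ R" "K_embedding_over (univ M) f N L"
    "K_embedding_over (univ M) g R L" "f a = g b"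
  shows "((a, M, N), (b, M, R)) \<in> E_at"
proof -
  have "L \<in> K" using assms(5) leq_in_K(2) by (auto simp: K_embedding_over_def K_embedding_def)
  then show ?thesis unfolding E_at_def using assms by blast
qed

lemma E_at_sym: "(s, t) \<in> E_at \<Longrightarrow> (t, s) \<in> E_at"
proof (cases s, cases t)
  fix a M N b M' R assume st: "(s, t) \<in> E_at" "s = (a, M, N)" "t = (b, M', R)"
  note D = E_atD[OF st(1)[unfolded st(2,3)]]
  obtain L f g where fg: "K_embedding_over (univ M) f N L" "K_embedding_over (univ M) g R L" "f a = g b"
    using D(6) by blast
  show "(t, s) \<in> E_at"
    unfolding st(2,3) D(1) by (rule E_atI[OF D(3,2,5,4) fg(2,1) fg(3)[symmetric]])
qed

lemma E_at_leq:
  assumes "M \<preceq> N" "N \<preceq> N'" "a \<in> univ N"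
  shows "((a, M, N), (a, M, N')) \<in> E_at"
proof (rule E_atI[where f = id and g = id])
  show "M \<preceq> N'" by (rule leq_trans[OF assms(1,2)])
  show "a \<in> univ N'" using assms(3) leq_univ[OF assms(2)] by blast
  show "K_embedding_over (univ M) id N N'" "K_embedding_over (univ M) id N' N'"
    using assms(2) leq_refl[OF leq_in_K(2)[OF assms(2)]]
    by (auto simp: K_embedding_over_def intro: K_embedding_ident)
qed (use assms in auto)

lemma tp_eqI:
  assumes "((a, M, N), (b, M, R)) \<in> E_at\<^sup>+"
  shows "tp a M N = tp b M R"
proof -
  have "sym E_at" using E_at_sym by (auto simp: sym_def)
  then have "((b, M, R), (a, M, N)) \<in> E_at\<^sup>+" using assms sym_trancl unfolding sym_def by blast
  then show ?thesis using assms unfolding tp_def by (auto intro: trancl_trans)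
qed

lemma tp_eqD:
  assumes "tp a M N = tp b M' R" "M' \<preceq> R" "b \<in> univ R"
  shows "((a, M, N), (b, M', R)) \<in> E_at\<^sup>+"
proof -
  have "((b, M', R), (b, M', R)) \<in> E_at" by (rule E_at_leq[OF assms(2) leq_refl[OF leq_in_K(2)[OF assms(2)]] assms(3)])
  then have "(b, M', R) \<in> tp b M' R" unfolding tp_def by auto
  then have "(b, M', R) \<in> tp a M N" using assms(1) by simp
  then show ?thesis unfolding tp_def by simp
qed

lemma tp_leq: "M \<preceq> N \<Longrightarrow> N \<preceq> N' \<Longrightarrow> a \<in> univ N \<Longrightarrow> tp a M N' = tp a M N"
  using tp_eqI[OF r_into_trancl[OF E_at_leq]] by metis

text \<open>
  The embeddings that witness an atomic equivalence over \<open>M\<close> fix \<open>M\<close> pointwise. Hence they also fix all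
  smaller models, and by injectivity they identify an element of \<open>M\<close> only with itself.
\<close>

lemma E_at_trancl:
  assumes "((a, M, N), (b, M', R)) \<in> E_at\<^sup>+"
  shows "M' = M \<and> M \<preceq> R \<and> b \<in> univ R \<and> (b \<in> univ M \<longleftrightarrow> a \<in> univ M) \<and>
    (\<forall>M0. M0 \<preceq> M \<longrightarrow> ((a, M0, N), (b, M0, R)) \<in> E_at\<^sup>+)"
proof -
  have single: "M' = M \<and> M \<preceq> R \<and> b \<in> univ R \<and> (b \<in> univ M \<longleftrightarrow> a \<in> univ M) \<and>
    (\<forall>M0. M0 \<preceq> M \<longrightarrow> ((a, M0, N), (b, M0, R)) \<in> E_at)"
    if E: "((a, M, N), (b, M', R)) \<in> E_at" for a M N b M' R
  proof -
    note D = E_atD[OF E]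
    obtain L f g where fg: "K_embedding_over (univ M) f N L" "K_embedding_over (univ M) g R L" "f a = g b"
      using D(6) by blast
    have f: "inj_on f (univ N)" "\<And>x. x \<in> univ M \<Longrightarrow> f x = x"
      and g: "inj_on g (univ R)" "\<And>x. x \<in> univ M \<Longrightarrow> g x = x"
      using fg by (auto simp: K_embedding_over_def K_embedding_iff)
    have "a = b" if "a \<in> univ M"
      using that fg(3) f(2)[of a] g D(5) leq_univ[OF D(3)] by (metis inj_onD subsetD)
    moreover have "a = b" if "b \<in> univ M"
      using that fg(3) g(2)[of b] f D(4) leq_univ[OF D(2)] by (metis inj_onD subsetD)
    moreover have "((a, M0, N), (b, M0, R)) \<in> E_at" if "M0 \<preceq> M" for M0
      using fg leq_univ[OF that]
      by (intro E_atI[OF leq_trans[OF that D(2)] leq_trans[OF that D(3)] D(4,5), of f L g])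
        (auto simp: K_embedding_over_def)
    ultimately show ?thesis using D by blast
  qed
  show ?thesis
    using assms
  proof (induction "(b, M', R)" arbitrary: b M' R rule: trancl_induct)
    case base
    show ?case using single[OF base] by blast
  next
    case (step t)
    obtain c M'' Q where t: "t = (c, M'', Q)" by (cases t)
    have 1: "M'' = M \<and> M \<preceq> Q \<and> c \<in> univ Q \<and> (c \<in> univ M \<longleftrightarrow> a \<in> univ M) \<and>
      (\<forall>M0. M0 \<preceq> M \<longrightarrow> ((a, M0, N), (c, M0, Q)) \<in> E_at\<^sup>+)"
      by (rule step.hyps(3)[OF t])
    then have M'': "M'' = M" by simp
    note 2 = single[OF step.hyps(2)[unfolded t M'']]
    have "((a, M0, N), (b, M0, R)) \<in> E_at\<^sup>+" if "M0 \<preceq> M" for M0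
      by (rule trancl_into_trancl[of _ "(c, M0, Q)"]) (use 1 2 that in simp_all)
    then show ?case using 1 2 by simp
  qed
qed

lemma restr_tp:
  assumes "M0 \<preceq> M" "M \<preceq> N" "a \<in> univ N"
  shows "restr (tp a M N) M0 = tp a M0 N"
proof -
  have mem: "(a, M, N) \<in> tp a M N"
    using E_at_leq[OF assms(2) leq_refl[OF leq_in_K(2)[OF assms(2)]] assms(3)]
    unfolding tp_def by auto
  have eq: "tp b M0 R = tp a M0 N" if "(b, M', R) \<in> tp a M N" for b M' R
    using E_at_trancl[of a M N b M' R] that assms(1) tp_eqI[of a M0 N b R] unfolding tp_def by simp
  show ?thesis
    unfolding restr_def
  proof (intro equalityI subsetI)
    fix t assume "t \<in> (\<Union>(b, M', R)\<in>tp a M N. tp b M0 R)"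
    then obtain b M' R where "(b, M', R) \<in> tp a M N" "t \<in> tp b M0 R" by auto
    then show "t \<in> tp a M0 N" using eq[of b M' R] by simp
  next
    fix t assume "t \<in> tp a M0 N"
    then show "t \<in> (\<Union>(b, M', R)\<in>tp a M N. tp b M0 R)"
      by (intro UN_I[OF mem]) simp
  qed
qed

lemma not_algebraic:
  assumes "tp a M N \<in> S_na M'" "M \<preceq> N" "a \<in> univ N"
  shows "a \<notin> univ M"
proof -
  obtain b R where b: "tp a M N = tp b M' R" "M' \<preceq> R" "b \<in> univ R" "b \<notin> univ M'"
    using assms(1) unfolding S_na_def by blast
  from E_at_trancl[OF tp_eqD[OF b(1,2,3)]] b(4) show ?thesis by blast
qed

lemma small_upper_bound:
  assumes A: "A \<preceq> L" "|univ A| \<le>o |C|" and B: "B \<preceq> L" "|univ B| \<le>o |C|" and C: "LS \<le>o |C|"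
  obtains L' where "L' \<preceq> L" "A \<preceq> L'" "B \<preceq> L'" "|univ L'| \<le>o |C|"
proof -
  have "|univ A \<union> univ B| \<le>o |C|"
    by (rule card_of_Un_ordLeq_infinite_Field)
      (use infinite_above_LS[OF C] A B in \<open>auto simp: Field_card_of card_of_card_order_on\<close>)
  moreover have "univ A \<union> univ B \<subseteq> univ L" using A B leq_univ by blast
  ultimately obtain L' where L': "L' \<preceq> L" "univ A \<union> univ B \<subseteq> univ L'" "|univ L'| \<le>o |C|"
    using Lowenheim_Skolem[OF leq_in_K(2)[OF A(1)] _ _ card_of_Card_order C] by blast
  moreover have "A \<preceq> L'" "B \<preceq> L'" using leq_coherence[OF A(1) L'(1)] leq_coherence[OF B(1) L'(1)] L'(2) by auto
  ultimately show ?thesis using that by blast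
qed

end


section \<open>Amalgamation of types in a frame\<close>

lemma less_bound_ordLeq: "|A| \<le>o |B| \<Longrightarrow> less_bound |B| \<mu> \<Longrightarrow> less_bound |A| \<mu>"
  using ordLeq_ordLess_trans by (auto simp: less_bound_def split: option.splits)

context w_good_frame
begin

lemma K_int_in_K: "M \<in> K_int \<Longrightarrow> M \<in> K"
  by (simp add: K_int_def)

lemma K_int_iff_Some:
  "\<mu> = Some m \<Longrightarrow> M \<in> K_int \<longleftrightarrow> M \<in> K \<and> lam \<le>o |univ M| \<and> |univ M| <o m"
  unfolding K_int_def less_bound_def by simp

lemma K_int_LS: "M \<in> K_int \<Longrightarrow> LS \<le>o |univ M|"
  using LS_le_lambda ordLeq_transitive unfolding K_int_def by blast

lemma K_intI:
  assumes "A \<in> K_int" "A \<preceq> M" "|univ M| \<le>o |univ N|" "N \<in> K_int"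
  shows "M \<in> K_int"
proof -
  have "lam \<le>o |univ A|" "|univ A| \<le>o |univ M|"
    using assms(1) card_of_mono1[OF leq_univ[OF assms(2)]] by (auto simp: K_int_def)
  then have "lam \<le>o |univ M|" by (rule ordLeq_transitive)
  then show ?thesis
    using assms leq_in_K(2)[OF assms(2)] less_bound_ordLeq by (auto simp: K_int_def)
qed

lemma K_int_img:
  assumes "M \<in> K_int" "inj_on f (univ M)"
  shows "img \<tau> f M \<in> K_int"
proof -
  have "|univ M| =o |univ (img \<tau> f M)|"
    using assms(2) by (intro card_of_ordIsoI[of f]) (simp add: inj_on_imp_bij_betw)
  then have "lam \<le>o |univ (img \<tau> f M)|" "less_bound |univ (img \<tau> f M)| \<mu>"
    using assms(1) ordLeq_ordIso_trans less_bound_ordLeq[of "univ (img \<tau> f M)" "univ M" \<mu>]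
      ordIso_imp_ordLeq[OF ordIso_symmetric] unfolding K_int_def by blast+
  then show ?thesis using img_in_K[OF K_int_in_K[OF assms(1)] assms(2)] by (simp add: K_int_def)
qed

lemma K_int_upper_bound:
  assumes A: "A \<preceq> L" "A \<in> K_int" and B: "B \<preceq> L" "B \<in> K_int"
  obtains L' where "L' \<preceq> L" "A \<preceq> L'" "B \<preceq> L'" "L' \<in> K_int"
proof -
  have refl: "|univ M| \<le>o |univ M|" for M :: "('f, 'r, 'u) struct"
    by (rule ordIso_imp_ordLeq[OF card_of_refl])
  have "|univ A| \<le>o |univ B| \<or> |univ B| \<le>o |univ A|"
    by (rule ordLeq_total[OF card_of_Well_order card_of_Well_order])
  then obtain N where N: "N \<in> K_int" "|univ A| \<le>o |univ N|" "|univ B| \<le>o |univ N|"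
    using A(2) B(2) refl by blast
  obtain L' where "L' \<preceq> L" "A \<preceq> L'" "B \<preceq> L'" "|univ L'| \<le>o |univ N|"
    by (rule small_upper_bound[OF A(1) N(2) B(1) N(3) K_int_LS[OF N(1)]])
  then show ?thesis using that K_intI[OF A(2) _ _ N(1)] by blast
qed

lemma K_int_submodel:
  assumes A: "A \<preceq> N" "A \<in> K_int" and a: "a \<in> univ N"
  obtains N' where "N' \<preceq> N" "A \<preceq> N'" "a \<in> univ N'" "N' \<in> K_int" "|univ N'| \<le>o |univ A|"
proof -
  have LS: "LS \<le>o |univ A|" by (rule K_int_LS[OF A(2)])
  have "|insert a (univ A)| \<le>o |univ A|"
    by (rule insert_ordLeq[OF ordIso_imp_ordLeq[OF card_of_refl] infinite_above_LS[OF LS]])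
  moreover have "insert a (univ A) \<subseteq> univ N" using a leq_univ[OF A(1)] by blast
  ultimately obtain N' where N': "N' \<preceq> N" "insert a (univ A) \<subseteq> univ N'" "|univ N'| \<le>o |univ A|"
    using Lowenheim_Skolem[OF leq_in_K(2)[OF A(1)] _ _ card_of_Card_order LS] by blast
  have "A \<preceq> N'" using leq_coherence[OF A(1) N'(1)] N'(2) by auto
  then show ?thesis using that N' K_intI[OF A(2) _ N'(3) A(2)] by blast
qed

text \<open>
  The amalgamation property of \<open>K_int\<close> speaks of extensions of a common submodel and gives an upper
  bound in \<open>K\<close>. Isomorphic copies and the Lowenheim-Skolem property turn it into the usual form.
\<close>

lemma amalgamation_of_embeddings:
  assumes M: "M \<in> K_int" and N: "N \<in> K_int" and R: "R \<in> K_int"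
    and f: "K_embedding f M N" and g: "K_embedding g M R"
  obtains R' h where "R \<preceq> R'" "R' \<in> K_int" "K_embedding h N R'" "\<And>x. x \<in> univ M \<Longrightarrow> h (f x) = g x"
proof -
  obtain p where p: "inj p" "M \<preceq> img \<tau> p N" "\<And>x. x \<in> univ M \<Longrightarrow> p (f x) = x"
    by (rule K_embedding_pull_back[OF f]) blast
  obtain q where q: "inj q" "M \<preceq> img \<tau> q R" "\<And>x. x \<in> univ M \<Longrightarrow> q (g x) = x"
    by (rule K_embedding_pull_back[OF g]) blast
  have inj: "inj_on p (univ N)" "inj_on q (univ R)" using p(1) q(1) inj_on_subset by blast+
  obtain R1 k where R1: "img \<tau> q R \<preceq> R1" and k: "K_embedding k (img \<tau> p N) R1"
    "\<And>x. x \<in> univ M \<Longrightarrow> k x = x"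
    using amalgamation M K_int_img[OF N inj(1)] K_int_img[OF R inj(2)] p(2) q(2)
    unfolding amalgamation_def K_embedding_over_def by meson
  have "K_embedding q R R1"
    using R1 K_int_in_K[OF R] inj(2) by (simp add: K_embedding_iff)
  then obtain u where u: "inj u" "R \<preceq> img \<tau> u R1" "\<And>x. x \<in> univ R \<Longrightarrow> u (q x) = x"
    by (rule K_embedding_pull_back) blast
  define h where "h = u \<circ> (k \<circ> p)"
  have R1K: "R1 \<in> K" by (rule leq_in_K(2)[OF R1])
  have uinj: "inj_on u (univ R1)" using u(1) inj_on_subset by blast
  have "K_embedding (k \<circ> p) N R1"
    by (rule K_embedding_comp[OF K_embedding_img[OF leq_refl[OF K_int_in_K[OF N]] inj(1)] k(1)])
  then have h: "K_embedding h N (img \<tau> u R1)"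
    unfolding h_def by (rule K_embedding_comp[OF _ K_embedding_img[OF leq_refl[OF R1K] uinj]])
  have hN: "inj_on h (univ N)" "img \<tau> h N \<preceq> img \<tau> u R1" using h by (auto simp: K_embedding_iff)
  obtain R' where R': "R \<preceq> R'" "img \<tau> h N \<preceq> R'" "R' \<in> K_int"
    by (rule K_int_upper_bound[OF u(2) R hN(2) K_int_img[OF N hN(1)]])
  have "K_embedding h N R'" using R'(2) hN(1) K_int_in_K[OF N] by (simp add: K_embedding_iff)
  moreover have "h (f x) = g x" if x: "x \<in> univ M" for x
  proof -
    have "g x \<in> univ R" using K_embedding_subset[OF g] x by blast
    then show ?thesis using u(3)[of "g x"] q(3)[OF x] p(3)[OF x] k(2)[OF x] by (simp add: h_def)
  qed
  ultimately show ?thesis using that R' by blast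
qed

text \<open>
  Equality of types over \<open>A\<close> is a chain of atomic equivalences, each witnessed by a model into which
  two of the models of the chain embed. Amalgamation composes the witnesses, provided that all
  models are first replaced by submodels in \<open>K_int\<close>.
\<close>

lemma realize_equal_type:
  assumes A: "A \<in> K_int" and N: "N \<in> K_int" "A \<preceq> N" "a \<in> univ N"
    and R: "R \<in> K_int" "A \<preceq> R" "b \<in> univ R"
    and eq: "tp a A N = tp b A R"
  obtains N' f where "N \<preceq> N'" "N' \<in> K_int" "K_embedding f R N'" "\<And>x. x \<in> univ A \<Longrightarrow> f x = x" "f b = a"
proof -
  \<comment> \<open>The models along the chain of equivalences need not be in \<open>K_int\<close>, so the claim is about their submodels.\<close>
  define Q where "Q b R \<longleftrightarrow> (\<forall>R'. R' \<preceq> R \<longrightarrow> A \<preceq> R' \<longrightarrow> b \<in> univ R' \<longrightarrow> R' \<in> K_int \<longrightarrow>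
    (\<exists>N' f. N \<preceq> N' \<and> N' \<in> K_int \<and> K_embedding f R' N' \<and> (\<forall>x\<in>univ A. f x = x) \<and> f b = a))" for b R
  have "((a, A, N), (b, A, R)) \<in> E_at\<^sup>*"
    by (rule trancl_into_rtrancl[OF tp_eqD[OF eq R(2,3)]])
  then have "Q b R"
  proof (induction "(b, A, R)" arbitrary: b R rule: rtrancl_induct)
    case base
    have "Q a N"
      unfolding Q_def
    proof (intro allI impI)
      fix R' assume "R' \<preceq> N"
      then have "K_embedding id R' N" by (rule K_embedding_ident) simp
      then show "\<exists>N' f. N \<preceq> N' \<and> N' \<in> K_int \<and> K_embedding f R' N' \<and> (\<forall>x\<in>univ A. f x = x) \<and> f a = a"
        using leq_refl[OF K_int_in_K[OF N(1)]] N(1) by (intro exI[of _ N] exI[of _ id]) auto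
    qed
    then show ?case by simp
  next
    case (step t)
    obtain c B R1 where t: "t = (c, B, R1)" by (cases t)
    note E = E_atD[OF step.hyps(2)[unfolded t]]
    have B: "B = A" using E(1) by simp
    have Q1: "Q c R1" using step.hyps(3) t B by simp
    obtain L f0 f1 where L: "K_embedding f0 R1 L" "K_embedding f1 R L"
      "\<And>x. x \<in> univ A \<Longrightarrow> f0 x = x" "\<And>x. x \<in> univ A \<Longrightarrow> f1 x = x" "f0 c = f1 b"
      using E(6) unfolding K_embedding_over_def B by blast
    have "Q b R"
      unfolding Q_def
    proof (intro allI impI)
      fix R' assume R': "R' \<preceq> R" "A \<preceq> R'" "b \<in> univ R'" "R' \<in> K_int"
      obtain R1' where R1': "R1' \<preceq> R1" "A \<preceq> R1'" "c \<in> univ R1'" "R1' \<in> K_int"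
        by (rule K_int_submodel[OF E(2)[unfolded B] A E(4)])
      obtain N1 f where N1: "N \<preceq> N1" "N1 \<in> K_int" "K_embedding f R1' N1"
        "\<And>x. x \<in> univ A \<Longrightarrow> f x = x" "f c = a"
        using Q1 R1' unfolding Q_def by blast
      have e0: "K_embedding f0 R1' L" by (rule K_embedding_restrict[OF L(1) R1'(1)])
      have e1: "K_embedding f1 R' L" by (rule K_embedding_restrict[OF L(2) R'(1)])
      have i0: "inj_on f0 (univ R1')" "img \<tau> f0 R1' \<preceq> L" and i1: "inj_on f1 (univ R')" "img \<tau> f1 R' \<preceq> L"
        using e0 e1 by (auto simp: K_embedding_iff)
      obtain L' where L': "img \<tau> f0 R1' \<preceq> L'" "img \<tau> f1 R' \<preceq> L'" "L' \<in> K_int"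
        by (rule K_int_upper_bound[OF i0(2) K_int_img[OF R1'(4) i0(1)] i1(2) K_int_img[OF R'(4) i1(1)]])
      have e0': "K_embedding f0 R1' L'" and e1': "K_embedding f1 R' L'"
        using e0 e1 L' by (auto simp: K_embedding_iff)
      obtain N2 h where N2: "N1 \<preceq> N2" "N2 \<in> K_int" "K_embedding h L' N2"
        "\<And>x. x \<in> univ R1' \<Longrightarrow> h (f0 x) = f x"
        by (rule amalgamation_of_embeddings[OF R1'(4) L'(3) N1(2) e0' N1(3)]) blast
      have "K_embedding (h \<circ> f1) R' N2" by (rule K_embedding_comp[OF e1' N2(3)])
      moreover have "(h \<circ> f1) x = x" if x: "x \<in> univ A" for x
        using N2(4)[of x] x leq_univ[OF R1'(2)] L(3,4)[OF x] N1(4)[OF x] by auto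
      moreover have "(h \<circ> f1) b = a" using N2(4)[OF R1'(3)] L(5) N1(5) by simp
      ultimately show "\<exists>N' f. N \<preceq> N' \<and> N' \<in> K_int \<and> K_embedding f R' N' \<and>
        (\<forall>x\<in>univ A. f x = x) \<and> f b = a"
        using leq_trans[OF N1(1) N2(1)] N2(2) by blast
    qed
    then show ?case by simp
  qed
  then show ?thesis
    using that leq_refl[OF K_int_in_K[OF R(1)]] R unfolding Q_def by blast
qed

text \<open>
  One amalgamation step that keeps the type of \<open>a\<close> basic: the nonforking extension of the type to
  \<open>B\<close> is realized by some \<open>b\<close>, and \<open>b\<close> is identified with \<open>a\<close>.
\<close>

lemma amalgamation_of_basic_type:
  assumes A: "A \<in> K_int" and N: "N \<in> K_int" "A \<preceq> N" "a \<in> univ N" and B: "B \<in> K_int" "A \<preceq> B"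
    and p: "tp a A N \<in> S_bs A"
  obtains N' g where "N \<preceq> N'" "N' \<in> K_int" "K_embedding g B N'" "\<And>x. x \<in> univ A \<Longrightarrow> g x = x"
    "tp a (img \<tau> g B) N' \<in> S_bs (img \<tau> g B)"
proof -
  obtain q where q: "q \<in> S_bs B" "restr q A = tp a A N"
    using nonforking_extension[OF p B(2,1)] by blast
  obtain b R where bR: "q = tp b B R" "B \<preceq> R" "b \<in> univ R" using q(1) by (auto simp: S_bs_def S_def)
  obtain R' where R': "R' \<preceq> R" "B \<preceq> R'" "b \<in> univ R'" "R' \<in> K_int"
    by (rule K_int_submodel[OF bR(2) B(1) bR(3)])
  have q': "q = tp b B R'" using bR(1) tp_leq[OF R'(2,1,3)] by simp
  have "tp a A N = tp b A R'" using q(2) restr_tp[OF B(2) R'(2,3)] unfolding q' by simp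
  then obtain N' f where N': "N \<preceq> N'" "N' \<in> K_int" "K_embedding f R' N'"
    "\<And>x. x \<in> univ A \<Longrightarrow> f x = x" "f b = a"
    by (rule realize_equal_type[OF A N R'(4) leq_trans[OF B(2) R'(2)] R'(3)]) blast
  have f: "inj_on f (univ R')" "img \<tau> f R' \<preceq> N'" using N'(3) by (auto simp: K_embedding_iff)
  have "tp (f b) (img \<tau> f B) (img \<tau> f R') \<in> S_bs (img \<tau> f B)"
    by (rule Sbs_invariance[OF iso_img[OF structs[OF K_int_in_K[OF R'(4)]] f(1)] R'(2,3)])
      (use q(1) q' in simp)
  moreover have "tp (f b) (img \<tau> f B) N' = tp (f b) (img \<tau> f B) (img \<tau> f R')"
    by (rule tp_leq[OF img_leq[OF R'(2) f(1)] f(2)]) (use R'(3) in simp)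
  ultimately have "tp a (img \<tau> f B) N' \<in> S_bs (img \<tau> f B)" using N'(5) by simp
  then show ?thesis using that[OF N'(1,2) K_embedding_restrict[OF N'(3) R'(2)] N'(4)] by blast
qed

lemma basic_not_algebraic:
  assumes "tp a A N \<in> S_bs A" "A \<preceq> N" "a \<in> univ N"
  shows "a \<notin> univ A"
  using assms Sbs_nonalgebraic not_algebraic[OF _ assms(2,3)] by (auto simp: S_bs_def)


section \<open>Proper extensions of models of size \<open>\<mu>\<close>\<close>

text \<open>
  A model \<open>M\<close> of size \<open>\<mu>\<close> is the union of a chain of smaller models, along which \<open>N0\<close> is amalgamated.
  The step yields \<open>P\<close> for all models between \<open>N\<close> and \<open>N'\<close> that contain the image, because the size
  bound along the chain requires that \<open>N'\<close> be replaced by a smaller model.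
\<close>

lemma amalgamation_with_large_model:
  assumes \<mu>: "\<mu> = Some m" and M: "|univ M| =o m" "M0 \<preceq> M"
    and M0: "M0 \<in> K_int" and N0: "N0 \<in> K_int" "M0 \<preceq> N0" "P M0 N0"
    and in_K_int: "\<And>A N. P A N \<Longrightarrow> A \<in> K_int"
    and up: "\<And>A N N'. P A N \<Longrightarrow> A \<preceq> N \<Longrightarrow> N \<preceq> N' \<Longrightarrow> P A N'"
    and step: "\<And>A B N. P A N \<Longrightarrow> A \<preceq> N \<Longrightarrow> A \<preceq> B \<Longrightarrow> N \<in> K_int \<Longrightarrow> B \<in> K_int \<Longrightarrow>
      \<exists>N' g. N \<preceq> N' \<and> N' \<in> K_int \<and> K_embedding g B N' \<and> (\<forall>x\<in>univ A. g x = x) \<and>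
        (\<forall>N''. N \<preceq> N'' \<longrightarrow> N'' \<preceq> N' \<longrightarrow> img \<tau> g B \<preceq> N'' \<longrightarrow> P (img \<tau> g B) N'')"
    and limit: "\<And>s As N. limit_ordinal (s :: 'u rel) \<Longrightarrow> less_bound s \<mu> \<Longrightarrow> chain s As \<Longrightarrow>
      (\<And>i. i \<in> Field s \<Longrightarrow> As i \<preceq> N \<and> P (As i) N) \<Longrightarrow>
      (\<And>i. i \<in> Field s \<Longrightarrow> As i \<preceq> union_struct \<tau> (Field s) As) \<Longrightarrow>
      union_struct \<tau> (Field s) As \<preceq> N \<Longrightarrow> union_struct \<tau> (Field s) As \<in> K_int \<Longrightarrow>
      P (union_struct \<tau> (Field s) As) N"
  obtains N f where "N0 \<preceq> N" "K_embedding f M N" "\<And>x. x \<in> univ M0 \<Longrightarrow> f x = x"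
    "\<And>x. x \<in> univ M \<Longrightarrow> \<exists>A. f x \<in> univ A \<and> A \<preceq> N \<and> P A N"
proof -
  have m: "infinite_cardinal m" using mu_cardinal[OF \<mu>] .
  have less: "|univ A| <o m" if "A \<in> K_int" for A
    using that K_int_iff_Some[OF \<mu>] by blast
  have small: "m <o |UNIV :: 'u set|" using m by (simp add: infinite_cardinal_def)
  have K_int_above: "B \<in> K_int" if "A \<in> K_int" "A \<preceq> B" "|univ B| <o m" for A B
  proof -
    have "lam \<le>o |univ B|"
      using that(1) card_of_mono1[OF leq_univ[OF that(2)]] ordLeq_transitive[of lam "|univ A|" "|univ B|"]
      by (simp add: K_int_def)
    then show ?thesis using that(3) leq_in_K(2)[OF that(2)] K_int_iff_Some[OF \<mu>] by blast
  qed
  have M0_N0: "|univ M0| \<le>o |univ N0|" by (rule card_of_mono1[OF leq_univ[OF N0(2)]])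
  obtain Ms where Ms: "chain m Ms" "union_struct \<tau> (Field m) Ms = M"
    "\<And>i. i \<in> Field m \<Longrightarrow> Ms i \<preceq> M" "\<And>i. i \<in> Field m \<Longrightarrow> M0 \<preceq> Ms i"
    "\<And>i. i \<in> Field m \<Longrightarrow> |univ (Ms i)| \<le>o seg_card (univ M0) m i"
    "\<And>i. i \<in> Field m \<Longrightarrow> underS m i = {} \<Longrightarrow> Ms i = M0"
    by (rule resolution_into_chain[OF m M(2) K_int_LS[OF M0] less[OF M0] ordIso_imp_ordLeq[OF M(1)]]) blast
  have size: "|univ (Ms i)| \<le>o seg_card (univ N0) m i" if "i \<in> Field m" for i
    by (rule ordLeq_transitive[OF Ms(5)[OF that] card_of_Plus_mono1[OF M0_N0]])
  have step': "\<exists>N' g. N \<preceq> N' \<and> |univ N'| \<le>o |C| \<and> K_embedding g B N' \<and> (\<forall>x\<in>univ A. g x = x) \<and>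
      P (img \<tau> g B) N'"
    if A: "A \<preceq> N" "A \<preceq> B" "P A N" and C: "LS \<le>o |C|" "|C| <o m" "|univ B| \<le>o |C|" "|univ N| \<le>o |C|"
    for A B N and C :: "('u + 'u) set"
  proof -
    have AK: "A \<in> K_int" by (rule in_K_int[OF A(3)])
    obtain N' g where N': "N \<preceq> N'" "K_embedding g B N'" "\<forall>x\<in>univ A. g x = x"
      and P: "\<And>N''. N \<preceq> N'' \<Longrightarrow> N'' \<preceq> N' \<Longrightarrow> img \<tau> g B \<preceq> N'' \<Longrightarrow> P (img \<tau> g B) N''"
      using step[OF A(3,1,2) K_int_above[OF AK A(1) ordLeq_ordLess_trans[OF C(4,2)]]
        K_int_above[OF AK A(2) ordLeq_ordLess_trans[OF C(3,2)]]] by blast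
    have g: "inj_on g (univ B)" "img \<tau> g B \<preceq> N'" "B \<in> K" using N'(2) by (auto simp: K_embedding_iff)
    obtain N'' where N'': "N'' \<preceq> N'" "N \<preceq> N''" "img \<tau> g B \<preceq> N''" "|univ N''| \<le>o |C|"
      by (rule small_upper_bound[OF N'(1) C(4) g(2) ordLeq_transitive[OF card_img C(3)] C(1)])
    then have "K_embedding g B N''" using g by (simp add: K_embedding_iff)
    then show ?thesis using N'' N'(3) P[OF N''(2,1,3)] by blast
  qed
  have limit': "P (union_struct \<tau> (Field s) As) N"
    if s: "limit_ordinal s" "s <o m" "chain s As"
      and As: "\<And>i. i \<in> Field s \<Longrightarrow> As i \<preceq> N \<and> P (As i) N"
      and U: "union_struct \<tau> (Field s) As \<preceq> N" "|univ (union_struct \<tau> (Field s) As)| <o m"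
    for s :: "'u rel" and As N
  proof (rule limit[OF s(1) _ s(3) As _ U(1)])
    show "less_bound s \<mu>" using s(2) \<mu> by (simp add: less_bound_def)
    show le: "As i \<preceq> union_struct \<tau> (Field s) As" if "i \<in> Field s" for i
      by (rule union_upper[OF s(1) ordLess_transitive[OF s(2) small] s(3) that])
    obtain i where i: "i \<in> Field s" using limit_ordinal_nonempty[OF s(1)] by blast
    show "union_struct \<tau> (Field s) As \<in> K_int"
      using in_K_int As[OF i] le[OF i] U(2) by (blast intro: K_int_above)
  qed
  obtain N f where N: "N0 \<preceq> N" "K_embedding f (union_struct \<tau> (Field m) Ms) N"
    "\<And>x. x \<in> univ M0 \<Longrightarrow> f x = x" "\<And>i. i \<in> Field m \<Longrightarrow> P (img \<tau> f (Ms i)) N"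
    by (rule amalgamation_along_chain[where P = P, OF m Ms(1,6,4) N0(2) K_int_LS[OF N0(1)] less[OF N0(1)]
        N0(3) size up step' limit']) blast+
  have emb: "K_embedding f M N" using N(2) unfolding Ms(2) .
  have "\<exists>A. f x \<in> univ A \<and> A \<preceq> N \<and> P A N" if x: "x \<in> univ M" for x
  proof -
    obtain i where i: "i \<in> Field m" "x \<in> univ (Ms i)" using x unfolding Ms(2)[symmetric] by auto
    have "img \<tau> f (Ms i) \<preceq> N" using K_embedding_restrict[OF emb Ms(3)[OF i(1)]] by (simp add: K_embedding_iff)
    then show ?thesis using N(4)[OF i(1)] i(2) by (intro exI[of _ "img \<tau> f (Ms i)"]) simp
  qed
  then show ?thesis using that N(1,3) emb by blast
qed

text \<open>Without constraints on types, plain amalgamation in \<open>K_int\<close> serves as the step.\<close>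

lemma amalgamation_large_small:
  assumes \<mu>: "\<mu> = Some m" and M: "|univ M| =o m" "M0 \<preceq> M"
    and M0: "M0 \<in> K_int" and N0: "N0 \<in> K_int" "M0 \<preceq> N0"
  obtains N f where "N0 \<preceq> N" "K_embedding f M N"
proof (rule amalgamation_with_large_model[where P = "\<lambda>A N. A \<in> K_int", OF \<mu> M M0 N0 M0])
  fix A B N assume A: "A \<in> K_int" "A \<preceq> N" "A \<preceq> B" and N: "N \<in> K_int" and B: "B \<in> K_int"
  have "K_embedding id A B" "K_embedding id A N" using A by (auto intro: K_embedding_ident)
  then obtain N' g where N': "N \<preceq> N'" "N' \<in> K_int" "K_embedding g B N'" "\<And>x. x \<in> univ A \<Longrightarrow> g x = x"
    using amalgamation_of_embeddings[OF A(1) B N, of id id] by auto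
  then have "img \<tau> g B \<in> K_int" using K_int_img[OF B] by (simp add: K_embedding_iff)
  then show "\<exists>N' g. N \<preceq> N' \<and> N' \<in> K_int \<and> K_embedding g B N' \<and> (\<forall>x\<in>univ A. g x = x) \<and>
    (\<forall>N''. N \<preceq> N'' \<longrightarrow> N'' \<preceq> N' \<longrightarrow> img \<tau> g B \<preceq> N'' \<longrightarrow> img \<tau> g B \<in> K_int)"
    using N' by blast
qed (use that in blast)+

text \<open>
  The invariant along the chain is that the type of \<open>a\<close> over the image is basic: nonforking extensions
  preserve it at successors, continuity at limits, and a basic type is not algebraic.
\<close>

lemma basic_type_omitted:
  assumes \<mu>: "\<mu> = Some m" and M: "|univ M| =o m" "M0 \<preceq> M"
    and M0: "M0 \<in> K_int" and N0: "N0 \<in> K_int" "M0 \<preceq> N0" "a \<in> univ N0" "tp a M0 N0 \<in> S_bs M0"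
  obtains N f where "a \<in> univ N" "K_embedding f M N" "a \<notin> f ` univ M"
proof -
  let ?P = "\<lambda>A N. A \<in> K_int \<and> A \<preceq> N \<and> a \<in> univ N \<and> tp a A N \<in> S_bs A"
  have P0: "?P M0 N0" using M0 N0 by blast
  obtain N f where N: "N0 \<preceq> N" "K_embedding f M N"
    "\<And>x. x \<in> univ M \<Longrightarrow> \<exists>A. f x \<in> univ A \<and> A \<preceq> N \<and> ?P A N"
  proof (rule amalgamation_with_large_model[where P = ?P, OF \<mu> M M0 N0(1,2) P0])
    fix A N N' assume P: "?P A N" and le: "A \<preceq> N" "N \<preceq> N'"
    then show "?P A N'" using tp_leq[OF le, of a] leq_trans[OF le] leq_univ[OF le(2)] by auto
  next
    fix A B N assume P: "?P A N" and B: "A \<preceq> B" "B \<in> K_int" and N: "N \<in> K_int"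
    then obtain N' g where N': "N \<preceq> N'" "N' \<in> K_int" "K_embedding g B N'" "\<And>x. x \<in> univ A \<Longrightarrow> g x = x"
      "tp a (img \<tau> g B) N' \<in> S_bs (img \<tau> g B)"
      using amalgamation_of_basic_type[of A N a B] by blast
    have gB: "img \<tau> g B \<in> K_int" using K_int_img[OF B(2)] N'(3) by (simp add: K_embedding_iff)
    have "?P (img \<tau> g B) N''" if "N \<preceq> N''" "N'' \<preceq> N'" "img \<tau> g B \<preceq> N''" for N''
      using gB that P leq_univ[OF that(1)] tp_leq[OF that(3,2), of a] N'(5) by auto
    then show "\<exists>N' g. N \<preceq> N' \<and> N' \<in> K_int \<and> K_embedding g B N' \<and> (\<forall>x\<in>univ A. g x = x) \<and>
      (\<forall>N''. N \<preceq> N'' \<longrightarrow> N'' \<preceq> N' \<longrightarrow> img \<tau> g B \<preceq> N'' \<longrightarrow> ?P (img \<tau> g B) N'')"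
      using N'(1-4) by blast
  next
    fix s :: "'u rel" and As N
    assume s: "limit_ordinal s" "less_bound s \<mu>" "chain s As"
      and As: "\<And>i. i \<in> Field s \<Longrightarrow> As i \<preceq> N \<and> ?P (As i) N"
      and le: "\<And>i. i \<in> Field s \<Longrightarrow> As i \<preceq> union_struct \<tau> (Field s) As"
      and U: "union_struct \<tau> (Field s) As \<preceq> N" "union_struct \<tau> (Field s) As \<in> K_int"
    let ?U = "union_struct \<tau> (Field s) As"
    have aN: "a \<in> univ N" using As limit_ordinal_nonempty[OF s(1)] by blast
    have "a \<notin> univ ?U" using As basic_not_algebraic by auto
    then have na: "tp a ?U N \<in> S_na ?U" using U(1) aN unfolding S_na_def by blast
    have "tp a ?U N \<in> S_bs ?U"
    proof (rule continuity[OF s _ refl U(2), where ps = "\<lambda>i. tp a (As i) N"])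
      show "As i \<in> K_int" "tp a (As i) N \<in> S_bs (As i)" if "i \<in> Field s" for i
        using As[OF that] by auto
      show "tp a (As i) N = restr (tp a (As j) N) (As i)" if "(i, j) \<in> s" for i j
      proof (rule restr_tp[symmetric])
        show "As i \<preceq> As j" using s(3) that by (simp add: chain_def)
        show "As j \<preceq> N" using As[OF FieldI2[OF that]] by blast
      qed (rule aN)
      show "restr (tp a ?U N) (As i) = tp a (As i) N" if "i \<in> Field s" for i
        by (rule restr_tp[OF le[OF that] U(1) aN])
    qed (rule na)
    then show "?P ?U N" using U aN by blast
  qed blast+
  have "a \<notin> f ` univ M" using N(3) basic_not_algebraic by blast
  then show ?thesis using that N(1,2) leq_univ[OF N(1)] N0(3) by blast
qed

text \<open>
  A maximal model of size \<open>\<mu>\<close> would contain copies of all small extensions of its small submodels. So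
  it would contain a model with a basic type; but such a type is realized outside of the model in some
  extension.
\<close>

lemma no_maximal_model_of_card_bound:
  assumes \<mu>: "\<mu> = Some m" and M: "M \<in> K" "|univ M| =o m"
  shows "\<exists>N. M \<prec> N"
proof (rule ccontr)
  assume "\<nexists>N. M \<prec> N"
  then have maximal: "N = M" if "M \<preceq> N" for N using that by blast
  have lam: "Card_order lam" using lambda_cardinal by (simp add: infinite_cardinal_def)
  have "lam <o m" using lambda_less_mu \<mu> by (simp add: less_bound_def)
  then have "lam <o |univ M|" using M(2) ordLess_ordIso_trans ordIso_symmetric by blast
  then have "|Field lam| \<le>o |univ M|"
    using card_of_Field_ordIso[OF lam] ordIso_ordLeq_trans ordLess_imp_ordLeq by blast
  then obtain e where e: "inj_on e (Field lam)" "e ` Field lam \<subseteq> univ M"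
    using card_of_ordLeq[of "Field lam" "univ M"] by blast
  have "|Field lam| =o |e ` Field lam|" using e(1) by (auto intro!: card_of_ordIsoI inj_on_imp_bij_betw)
  then have e_card: "lam =o |e ` Field lam|"
    using card_of_Field_ordIso[OF lam] ordIso_symmetric ordIso_transitive by blast
  obtain M0 where M0: "M0 \<preceq> M" "e ` Field lam \<subseteq> univ M0" "|univ M0| \<le>o lam"
    by (rule Lowenheim_Skolem[OF M(1) e(2) ordIso_imp_ordLeq[OF ordIso_symmetric[OF e_card]] lam LS_le_lambda])
  have ge: "lam \<le>o |univ M0|" by (rule ordIso_ordLeq_trans[OF e_card card_of_mono1[OF M0(2)]])
  then have "|univ M0| =o lam" using M0(3) by (simp add: ordIso_iff_ordLeq)
  then have M0_lam: "M0 \<in> K_card lam" using leq_in_K(1)[OF M0(1)] by (simp add: K_card_def)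
  have M0_int: "M0 \<in> K_int"
    using ge leq_in_K(1)[OF M0(1)] ordLeq_ordLess_trans[OF M0(3) \<open>lam <o m\<close>] K_int_iff_Some[OF \<mu>]
    by blast
  obtain N1 where N1: "M0 \<prec> N1" using no_maximal_models M0_int unfolding no_maximal_models_def by blast
  then obtain b where b: "b \<in> univ N1" "b \<notin> univ M0" using leq_univ_eq[of M0 N1] leq_univ[of M0 N1] by blast
  obtain N2 where N2: "M0 \<preceq> N2" "b \<in> univ N2" "N2 \<in> K_int"
    by (rule K_int_submodel[OF conjunct1[OF N1] M0_int b(1)])
  have "M0 \<prec> N2" using N2 b(2) by blast
  from weak_density[OF M0_lam N2(3) this]
  obtain a M' N' where M': "M' \<in> K_int" "N' \<in> K_int" "M' \<preceq> N'" "a \<in> univ N'"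
    "tp a M' N' \<in> S_bs M'" "M0 \<preceq> M'" by blast
  \<comment> \<open>By maximality, the copy \<open>u[M']\<close> lies inside \<open>M\<close>.\<close>
  obtain N f where N: "M' \<preceq> N" "K_embedding f M N"
    by (rule amalgamation_large_small[OF \<mu> M(2) M0(1) M0_int M'(1,6)])
  obtain u where u: "inj u" "M \<preceq> img \<tau> u N" by (rule K_embedding_pull_back[OF N(2)]) blast
  have inj: "inj_on u X" for X using u(1) by (rule inj_on_subset) simp
  have "img \<tau> u M' \<preceq> M" using img_leq[OF N(1) inj] maximal[OF u(2)] by simp
  moreover have "tp (u a) (img \<tau> u M') (img \<tau> u N') \<in> S_bs (img \<tau> u M')"
    by (rule Sbs_invariance[OF iso_img[OF structs[OF K_int_in_K[OF M'(2)]] inj] M'(3-5)])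
  ultimately obtain N3 g where N3: "u a \<in> univ N3" "K_embedding g M N3" "u a \<notin> g ` univ M"
    using basic_type_omitted[OF \<mu> M(2) _ K_int_img[OF M'(1) inj] K_int_img[OF M'(2) inj]
        img_leq[OF M'(3) inj], of "u a"] M'(4) by auto
  obtain w where w: "inj w" "M \<preceq> img \<tau> w N3" "\<And>x. x \<in> univ M \<Longrightarrow> w (g x) = x"
    by (rule K_embedding_pull_back[OF N3(2)]) blast
  have wM: "w (u a) \<in> univ M" using maximal[OF w(2)] N3(1) by (metis image_eqI img_simps)
  then have "w (g (w (u a))) = w (u a)" by (rule w(3))
  then have "g (w (u a)) = u a" using w(1) by (simp add: inj_eq)
  then show False using N3(3) wM by (metis image_eqI)
qed

end

theorem theorem3p18:
  fixes \<tau> :: "('f, 'r) vocab"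
    and K :: "('f, 'r, 'u) struct set"
    and leq :: "('f, 'r, 'u) struct rel"
    and lam :: "'u rel"
    and \<mu> :: "'u rel option"
    and nf :: "('f, 'r, 'u) struct \<Rightarrow> ('f, 'r, 'u) struct \<Rightarrow> 'u \<Rightarrow> ('f, 'r, 'u) struct \<Rightarrow> bool"
    and Sbs :: "('f, 'r, 'u) gtype set"
  assumes universe_regular: "regularCard |UNIV :: 'u set|"
    and universe_large: "\<And>m. \<mu> = Some m \<Longrightarrow> cardSuc m <o |UNIV :: 'u set|"
    and frame: "w_good_frame \<tau> K leq lam \<mu> nf Sbs"
  shows "\<forall>\<kappa> :: 'u rel. Card_order \<kappa> \<and> lam \<le>o \<kappa> \<and> le_succ_bound \<kappa> \<mu> \<longrightarrow>
           structure_class.K_card K \<kappa> \<noteq> {}"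
proof (intro allI impI, elim conjE)
  fix \<kappa> :: "'u rel"
  assume card: "Card_order \<kappa>" and ge: "lam \<le>o \<kappa>" and le: "le_succ_bound \<kappa> \<mu>"
  interpret w_good_frame \<tau> K leq lam \<mu> nf Sbs by (rule frame)
  obtain M0 where M0: "M0 \<in> K" "|univ M0| =o lam" using K_lambda_nonempty by (auto simp: K_card_def)
  show "K_card \<kappa> \<noteq> {}"
  proof (cases "lam =o \<kappa>")
    case True
    then have "M0 \<in> K_card \<kappa>" using M0 ordIso_transitive by (auto simp: K_card_def)
    then show ?thesis by blast
  next
    case False
    then have less: "lam <o \<kappa>" using ge by (simp add: ordLeq_iff_ordLess_or_ordIso)
    have "infinite (Field lam)" using lambda_cardinal by (simp add: infinite_cardinal_def)
    then have "infinite (Field \<kappa>)" using cinfinite_mono[OF ge] by (simp add: cinfinite_def)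
    moreover have "\<kappa> <o |UNIV :: 'u set|"
      using le universe_large ordLeq_ordLess_trans
      by (cases \<mu>) (auto simp: le_succ_bound_def)
    ultimately have \<kappa>: "infinite_cardinal \<kappa>" using card by (simp add: infinite_cardinal_def)
    have M0_ge: "lam \<le>o |univ M0|" by (rule ordIso_imp_ordLeq[OF ordIso_symmetric[OF M0(2)]])
    show ?thesis
    proof (rule exists_model_of_card[OF \<kappa> M0(1) ordLeq_transitive[OF LS_le_lambda M0_ge]
          ordIso_ordLess_trans[OF M0(2) less]])
      fix M assume M: "M \<in> K" "|univ M0| \<le>o |univ M|" "|univ M| <o \<kappa>"
      have lam: "lam \<le>o |univ M|" by (rule ordLeq_transitive[OF M0_ge M(2)])
      \<comment> \<open>Sizes below \<open>\<kappa> \<le> \<mu>\<^sup>+\<close> are at most \<open>\<mu>\<close>.\<close>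
      have "M \<in> K_int \<or> (\<exists>m. \<mu> = Some m \<and> |univ M| =o m)"
      proof (cases \<mu>)
        case None
        have "|univ M| <o |UNIV :: 'u set|" using structs[OF M(1)] by (simp add: is_struct_def set_sized_def)
        then show ?thesis using M(1) lam None unfolding K_int_def less_bound_def by simp
      next
        case (Some m)
        have m: "Card_order m" using mu_cardinal[OF Some] by (simp add: infinite_cardinal_def)
        have "\<kappa> \<le>o cardSuc m" using le Some by (simp add: le_succ_bound_def)
        then have "|univ M| <o cardSuc m" by (rule ordLess_ordLeq_trans[OF M(3)])
        then have "|univ M| \<le>o m" using cardSuc_ordLeq_ordLess[OF m card_of_Card_order] by blast
        then show ?thesis
          using M(1) lam Some K_int_iff_Some[OF Some] ordLeq_iff_ordLess_or_ordIso by blast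
      qed
      then show "\<exists>N. M \<prec> N"
        using no_maximal_models no_maximal_model_of_card_bound[OF _ M(1)]
        unfolding no_maximal_models_def by blast
    qed
  qed
qed

end
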